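(* Let $(M,\varphi,\xi,\eta,g)$ be a $(2n+1)$-dimensional almost contact manifold with Norden metric, with Levi-Civita connection $\nabla$ of $g$. For arbitrary real numbers $p_1,p_2,p_3,p_4$ let $\nabla''$ be the linear connection defined, for all vector fields $x,y,z$, by $$ \begin{aligned} g(\nabla''_xy-\nabla_xy,z)&=\tfrac12\{F(x,\varphi y,z)+F(x,\varphi y,\xi)\eta(z)\}-F(x,\varphi z,\xi)\eta(y)\\ &+p_1\{N(y,z,\varphi x)+N(\xi,y,\varphi x)\eta(z)+N(z,\xi,\varphi x)\eta(y)\}\\ &+p_2\{N(z,y,x)+N(y,\xi,x)\eta(z)+N(\xi,z,x)\eta(y)\}\\ &+p_3\{N(\varphi^2z,y,\xi)+N(z,\xi,\xi)\eta(y)\}\eta(x)\\ &+p_4\{N(y,\varphi z,\xi)+N(\varphi z,\xi,\xi)\eta(y)\}\eta(x). \end{aligned} $$ Then $\nabla''$ is a natural connection, i.e. $\nabla''\varphi=\nabla''\eta=\nabla''g=0$, for every choice of $(p_1,p_2,p_3,p_4)\in\mathbb{R}^4$.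
   Context: An almost contact manifold with Norden metric $(M,\varphi,\xi,\eta,g)$ is a smooth $(2n+1)$-dimensional manifold $M$ with an endomorphism $\varphi$ of the tangent bundle, a vector field $\xi$, a 1-form $\eta$ and a pseudo-Riemannian metric $g$ such that $\varphi^2x=-x+\eta(x)\xi$, $\eta(\xi)=1$, $g(\varphi x,\varphi y)=-g(x,y)+\eta(x)\eta(y)$ for all vector fields $x,y$. (Consequently $\varphi\xi=0$, $\eta\circ\varphi=0$, $\eta(x)=g(x,\xi)$, $g(\varphi x,y)=g(x,\varphi y)$.) The fundamental tensor is $F(x,y,z)=g((\nabla_x\varphi)y,z)$, where $\nabla$ is the Levi-Civita connection of $g$. The Nijenhuis tensor of the almost contact structure is $$N(x,y)=\varphi^2[x,y]+[\varphi x,\varphi y]-\varphi[\varphi x,y]-\varphi[x,\varphi y]+\big((\nabla_x\eta)y-(\nabla_y\eta)x\big)\xi,$$ and $N(x,y,z)=g(N(x,y),z)$; equivalently $N(x,y,z)=F(\varphi x,y,z)-F(\varphi y,x,z)-F(x,y,\varphi z)+F(y,x,\varphi z)+F(x,\varphi y,\xi)\eta(z)-F(y,\varphi x,\xi)\eta(z)$. A linear connection $\nabla'$ on $(M,\varphi,\xi,\eta,g)$ is called natural if $\nabla'\varphi=\nabla'\eta=\nabla'g=0$. *)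

theory Defs
  imports "HOL-Analysis.Analysis" "HOL-Library.Function_Algebras"
begin

text \<open>Functions, tangent vectors and vector fields are all represented by functions, and
  their sums, differences and zero are the pointwise ones of \<^theory>\<open>HOL-Library.Function_Algebras\<close>.\<close>

subsection \<open>Smooth manifolds\<close>

text \<open>Used for open \<open>S\<close> in a finite-dimensional space only. There the existence and continuity
  of all iterated directional derivatives is the usual notion of class $C^k$.\<close>

primrec Ck_on :: "nat \<Rightarrow> 'a::real_normed_vector set \<Rightarrow> ('a \<Rightarrow> 'b::real_normed_vector) \<Rightarrow> bool" where
  "Ck_on 0 S f \<longleftrightarrow> continuous_on S f"
| "Ck_on (Suc k) S f \<longleftrightarrow>
     (\<forall>x\<in>S. f differentiable (at x)) \<and> (\<forall>v. Ck_on k S (\<lambda>x. frechet_derivative f (at x) v))"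

definition smooth_on :: "'a::real_normed_vector set \<Rightarrow> ('a \<Rightarrow> 'b::real_normed_vector) \<Rightarrow> bool" where
  "smooth_on S f \<longleftrightarrow> (\<forall>k. Ck_on k S f)"

text \<open>A chart is a domain together with a coordinate map; only the values of the coordinate map
  on the domain matter. The manifold is the whole type \<open>'m\<close>, its dimension is that of the model
  space \<open>'e\<close>.\<close>

type_synonym ('m, 'e) chart = "'m set \<times> ('m \<Rightarrow> 'e)"

definition is_chart :: "('m::topological_space, 'e::euclidean_space) chart \<Rightarrow> bool" where
  "is_chart = (\<lambda>(U, \<psi>). open U \<and> open (\<psi> ` U) \<and> (\<exists>\<psi>'. homeomorphism U (\<psi> ` U) \<psi> \<psi>'))"

definition smooth_atlas ::
  "('m::{t2_space,second_countable_topology}, 'e::euclidean_space) chart set \<Rightarrow> bool" where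
  "smooth_atlas \<A> \<longleftrightarrow>
     (\<forall>c\<in>\<A>. is_chart c) \<and>
     (\<Union>(U, \<psi>)\<in>\<A>. U) = UNIV \<and>
     (\<forall>(U, \<psi>)\<in>\<A>. \<forall>(V, \<theta>)\<in>\<A>. smooth_on (\<psi> ` (U \<inter> V)) (\<theta> \<circ> inv_into U \<psi>))"

definition smooth_functions :: "('m, 'e::euclidean_space) chart set \<Rightarrow> ('m \<Rightarrow> real) set" where
  "smooth_functions \<A> = {f. \<forall>(U, \<psi>)\<in>\<A>. smooth_on (\<psi> ` U) (f \<circ> inv_into U \<psi>)}"


subsection \<open>Tangent vectors and vector fields\<close>

text \<open>A tangent vector is given by a chart and a coordinate vector \<open>u\<close>; it is represented by the
  directional derivative it induces on smooth functions (extended by \<open>0\<close> to all functions), so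
  that two such pairs related by a change of coordinates give the same object.\<close>

type_synonym 'm tangent = "('m \<Rightarrow> real) \<Rightarrow> real"

definition coord_tangent ::
  "('m, 'e::euclidean_space) chart set \<Rightarrow> ('m, 'e) chart \<Rightarrow> 'm \<Rightarrow> 'e \<Rightarrow> 'm tangent" where
  "coord_tangent \<A> = (\<lambda>(U, \<psi>) q u f.
     if f \<in> smooth_functions \<A> then frechet_derivative (f \<circ> inv_into U \<psi>) (at (\<psi> q)) u else 0)"

definition tangent_space :: "('m, 'e::euclidean_space) chart set \<Rightarrow> 'm \<Rightarrow> 'm tangent set" where
  "tangent_space \<A> q = {coord_tangent \<A> c q u |c u. c \<in> \<A> \<and> q \<in> fst c}"

type_synonym 'm vfield = "'m \<Rightarrow> 'm tangent"

definition vector_fields :: "('m, 'e::euclidean_space) chart set \<Rightarrow> 'm vfield set" where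
  "vector_fields \<A> = {X. (\<forall>q. X q \<in> tangent_space \<A> q) \<and>
     (\<forall>f\<in>smooth_functions \<A>. (\<lambda>q. X q f) \<in> smooth_functions \<A>)}"

definition fscale :: "('m \<Rightarrow> real) \<Rightarrow> 'm vfield \<Rightarrow> 'm vfield"  (infixr "\<odot>" 75) where
  "f \<odot> X = (\<lambda>q h. f q * X q h)"

definition lie_bracket :: "'m vfield \<Rightarrow> 'm vfield \<Rightarrow> 'm vfield" where
  "lie_bracket X Y = (\<lambda>q f. X q (\<lambda>r. Y r f) - Y q (\<lambda>r. X r f))"


subsection \<open>Tensor fields\<close>

text \<open>Tensor fields are families of (multi)linear maps on the tangent spaces; smoothness means that
  smooth vector fields are sent to smooth vector fields or functions.\<close>

type_synonym 'm endo = "'m \<Rightarrow> 'm tangent \<Rightarrow> 'm tangent"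
type_synonym 'm form = "'m \<Rightarrow> 'm tangent \<Rightarrow> real"
type_synonym 'm bilin = "'m \<Rightarrow> 'm tangent \<Rightarrow> 'm tangent \<Rightarrow> real"

definition endo_app :: "'m endo \<Rightarrow> 'm vfield \<Rightarrow> 'm vfield"  (infixr "\<bullet>\<^sub>e" 80) where
  "\<phi> \<bullet>\<^sub>e X = (\<lambda>q. \<phi> q (X q))"

definition tangent_endomorphism :: "('m, 'e::euclidean_space) chart set \<Rightarrow> 'm endo \<Rightarrow> bool" where
  "tangent_endomorphism \<A> \<phi> \<longleftrightarrow>
     (\<forall>q. \<forall>v\<in>tangent_space \<A> q. \<phi> q v \<in> tangent_space \<A> q) \<and>
     (\<forall>q. \<forall>v\<in>tangent_space \<A> q. \<forall>w\<in>tangent_space \<A> q. \<phi> q (v + w) = \<phi> q v + \<phi> q w) \<and>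
     (\<forall>q. \<forall>v\<in>tangent_space \<A> q. \<forall>c. \<phi> q (\<lambda>h. c * v h) = (\<lambda>h. c * \<phi> q v h)) \<and>
     (\<forall>X\<in>vector_fields \<A>. \<phi> \<bullet>\<^sub>e X \<in> vector_fields \<A>)"

definition one_form :: "('m, 'e::euclidean_space) chart set \<Rightarrow> 'm form \<Rightarrow> bool" where
  "one_form \<A> \<eta> \<longleftrightarrow>
     (\<forall>q. \<forall>v\<in>tangent_space \<A> q. \<forall>w\<in>tangent_space \<A> q. \<eta> q (v + w) = \<eta> q v + \<eta> q w) \<and>
     (\<forall>q. \<forall>v\<in>tangent_space \<A> q. \<forall>c. \<eta> q (\<lambda>h. c * v h) = c * \<eta> q v) \<and>
     (\<forall>X\<in>vector_fields \<A>. (\<lambda>q. \<eta> q (X q)) \<in> smooth_functions \<A>)"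

text \<open>No condition on the signature is imposed. For the metrics below it is constant anyway:
  compatibility with the almost contact structure forces it to be $(n+1,n)$.\<close>

definition pseudo_riemannian_metric :: "('m, 'e::euclidean_space) chart set \<Rightarrow> 'm bilin \<Rightarrow> bool" where
  "pseudo_riemannian_metric \<A> g \<longleftrightarrow>
     (\<forall>q. \<forall>u\<in>tangent_space \<A> q. \<forall>v\<in>tangent_space \<A> q. \<forall>w\<in>tangent_space \<A> q.
        g q (u + v) w = g q u w + g q v w) \<and>
     (\<forall>q. \<forall>v\<in>tangent_space \<A> q. \<forall>w\<in>tangent_space \<A> q. \<forall>c. g q (\<lambda>h. c * v h) w = c * g q v w) \<and>
     (\<forall>q. \<forall>v\<in>tangent_space \<A> q. \<forall>w\<in>tangent_space \<A> q. g q v w = g q w v) \<and>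
     (\<forall>q. \<forall>v\<in>tangent_space \<A> q. (\<forall>w\<in>tangent_space \<A> q. g q v w = 0) \<longrightarrow> v = 0) \<and>
     (\<forall>X\<in>vector_fields \<A>. \<forall>Y\<in>vector_fields \<A>. (\<lambda>q. g q (X q) (Y q)) \<in> smooth_functions \<A>)"


subsection \<open>Linear connections\<close>

text \<open>Linearity over the reals in the second argument is additivity together with the Leibniz rule
  for constant functions.\<close>

definition linear_connection ::
  "('m, 'e::euclidean_space) chart set \<Rightarrow> ('m vfield \<Rightarrow> 'm vfield \<Rightarrow> 'm vfield) \<Rightarrow> bool" where
  "linear_connection \<A> D \<longleftrightarrow>
     (\<forall>X\<in>vector_fields \<A>. \<forall>Y\<in>vector_fields \<A>. D X Y \<in> vector_fields \<A>) \<and>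
     (\<forall>X\<in>vector_fields \<A>. \<forall>Y\<in>vector_fields \<A>. \<forall>Z\<in>vector_fields \<A>.
        D (X + Y) Z = D X Z + D Y Z \<and> D X (Y + Z) = D X Y + D X Z) \<and>
     (\<forall>f\<in>smooth_functions \<A>. \<forall>X\<in>vector_fields \<A>. \<forall>Y\<in>vector_fields \<A>.
        D (f \<odot> X) Y = f \<odot> D X Y \<and> D X (f \<odot> Y) = (\<lambda>q. X q f) \<odot> Y + f \<odot> D X Y)"

definition cov_endo ::
  "('m vfield \<Rightarrow> 'm vfield \<Rightarrow> 'm vfield) \<Rightarrow> 'm endo \<Rightarrow> 'm vfield \<Rightarrow> 'm vfield \<Rightarrow> 'm vfield" where
  "cov_endo D \<phi> X Y = D X (\<phi> \<bullet>\<^sub>e Y) - \<phi> \<bullet>\<^sub>e D X Y"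

definition cov_form ::
  "('m vfield \<Rightarrow> 'm vfield \<Rightarrow> 'm vfield) \<Rightarrow> 'm form \<Rightarrow> 'm vfield \<Rightarrow> 'm vfield \<Rightarrow> 'm \<Rightarrow> real" where
  "cov_form D \<eta> X Y = (\<lambda>q. X q (\<lambda>r. \<eta> r (Y r)) - \<eta> q (D X Y q))"

definition cov_bilin ::
  "('m vfield \<Rightarrow> 'm vfield \<Rightarrow> 'm vfield) \<Rightarrow> 'm bilin \<Rightarrow> 'm vfield \<Rightarrow> 'm vfield \<Rightarrow> 'm vfield \<Rightarrow> 'm \<Rightarrow> real" where
  "cov_bilin D g X Y Z =
     (\<lambda>q. X q (\<lambda>r. g r (Y r) (Z r)) - g q (D X Y q) (Z q) - g q (Y q) (D X Z q))"

definition levi_civita ::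
  "('m, 'e::euclidean_space) chart set \<Rightarrow> 'm bilin \<Rightarrow> ('m vfield \<Rightarrow> 'm vfield \<Rightarrow> 'm vfield) \<Rightarrow> bool" where
  "levi_civita \<A> g D \<longleftrightarrow> linear_connection \<A> D \<and>
     (\<forall>X\<in>vector_fields \<A>. \<forall>Y\<in>vector_fields \<A>. D X Y - D Y X = lie_bracket X Y) \<and>
     (\<forall>X\<in>vector_fields \<A>. \<forall>Y\<in>vector_fields \<A>. \<forall>Z\<in>vector_fields \<A>. cov_bilin D g X Y Z = 0)"


subsection \<open>Almost contact structures with Norden metric\<close>

definition almost_contact_norden ::
  "('m, 'e::euclidean_space) chart set \<Rightarrow> 'm endo \<Rightarrow> 'm vfield \<Rightarrow> 'm form \<Rightarrow> 'm bilin \<Rightarrow> bool" where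
  "almost_contact_norden \<A> \<phi> \<xi> \<eta> g \<longleftrightarrow>
     tangent_endomorphism \<A> \<phi> \<and> \<xi> \<in> vector_fields \<A> \<and> one_form \<A> \<eta> \<and>
     pseudo_riemannian_metric \<A> g \<and>
     (\<forall>X\<in>vector_fields \<A>. \<phi> \<bullet>\<^sub>e \<phi> \<bullet>\<^sub>e X = - X + (\<lambda>q. \<eta> q (X q)) \<odot> \<xi>) \<and>
     (\<forall>q. \<eta> q (\<xi> q) = 1) \<and>
     (\<forall>X\<in>vector_fields \<A>. \<forall>Y\<in>vector_fields \<A>. \<forall>q.
        g q (\<phi> q (X q)) (\<phi> q (Y q)) = - g q (X q) (Y q) + \<eta> q (X q) * \<eta> q (Y q))"

definition fundamental_tensor ::
  "'m endo \<Rightarrow> 'm bilin \<Rightarrow> ('m vfield \<Rightarrow> 'm vfield \<Rightarrow> 'm vfield) \<Rightarrow>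
   'm vfield \<Rightarrow> 'm vfield \<Rightarrow> 'm vfield \<Rightarrow> 'm \<Rightarrow> real" where
  "fundamental_tensor \<phi> g D X Y Z = (\<lambda>q. g q (cov_endo D \<phi> X Y q) (Z q))"

definition nijenhuis_field ::
  "'m endo \<Rightarrow> 'm vfield \<Rightarrow> 'm form \<Rightarrow> ('m vfield \<Rightarrow> 'm vfield \<Rightarrow> 'm vfield) \<Rightarrow>
   'm vfield \<Rightarrow> 'm vfield \<Rightarrow> 'm vfield" where
  "nijenhuis_field \<phi> \<xi> \<eta> D X Y =
     \<phi> \<bullet>\<^sub>e \<phi> \<bullet>\<^sub>e lie_bracket X Y + lie_bracket (\<phi> \<bullet>\<^sub>e X) (\<phi> \<bullet>\<^sub>e Y)
     - \<phi> \<bullet>\<^sub>e lie_bracket (\<phi> \<bullet>\<^sub>e X) Y - \<phi> \<bullet>\<^sub>e lie_bracket X (\<phi> \<bullet>\<^sub>e Y)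
     + (cov_form D \<eta> X Y - cov_form D \<eta> Y X) \<odot> \<xi>"

definition nijenhuis_tensor ::
  "'m endo \<Rightarrow> 'm vfield \<Rightarrow> 'm form \<Rightarrow> 'm bilin \<Rightarrow> ('m vfield \<Rightarrow> 'm vfield \<Rightarrow> 'm vfield) \<Rightarrow>
   'm vfield \<Rightarrow> 'm vfield \<Rightarrow> 'm vfield \<Rightarrow> 'm \<Rightarrow> real" where
  "nijenhuis_tensor \<phi> \<xi> \<eta> g D X Y Z = (\<lambda>q. g q (nijenhuis_field \<phi> \<xi> \<eta> D X Y q) (Z q))"

definition natural_connection ::
  "('m, 'e::euclidean_space) chart set \<Rightarrow> 'm endo \<Rightarrow> 'm form \<Rightarrow> 'm bilin \<Rightarrow>
   ('m vfield \<Rightarrow> 'm vfield \<Rightarrow> 'm vfield) \<Rightarrow> bool" where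
  "natural_connection \<A> \<phi> \<eta> g D \<longleftrightarrow> linear_connection \<A> D \<and>
     (\<forall>X\<in>vector_fields \<A>. \<forall>Y\<in>vector_fields \<A>. cov_endo D \<phi> X Y = 0) \<and>
     (\<forall>X\<in>vector_fields \<A>. \<forall>Y\<in>vector_fields \<A>. cov_form D \<eta> X Y = 0) \<and>
     (\<forall>X\<in>vector_fields \<A>. \<forall>Y\<in>vector_fields \<A>. \<forall>Z\<in>vector_fields \<A>. cov_bilin D g X Y Z = 0)"

end

theory Submission
  imports Defs "HOL-Computational_Algebra.Polynomial"
begin

text \<open>Every tangent vector extends to a smooth vector field (cut off by a bump function in a
  chart), so an identity between vector fields may be tested against $g(\cdot,z)$ for all fields
  \<open>z\<close>. Let $H(x,y,w) = N(x,y,w) + N(\xi,x,w)\eta(y) + N(y,\xi,w)\eta(x)$ be the part of the Nijenhuis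
  tensor that is horizontal in its first two arguments. The terms with $p_1,\dots,p_4$ in
  $g(\nabla''_xy - \nabla_xy, z)$ are $H(y,z,\varphi x)$, $-H(y,z,x)$, $\eta(x)H(y,z,\xi)$ and
  $\eta(x)H(y,\varphi z,\xi)$. Now $H$ is skew in its first two arguments, vanishes if one of them is
  $\xi$, and satisfies $H(\varphi x,y,w) = H(x,\varphi y,w)$; these three properties say that the
  parameters do not affect $\nabla''g$, $\nabla''\eta$ and $\nabla''\varphi$. What remains is the case
  $p_i = 0$.\<close>

subsection \<open>Calculus of class $C^k$ and bump functions\<close>

lemma Ck_on_Suc_imp: "Ck_on (Suc k) S f \<Longrightarrow> Ck_on k S f"
proof (induction k arbitrary: f)
  case 0
  then show ?case
    by (auto intro!: continuous_at_imp_continuous_on differentiable_imp_continuous_within)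
next
  case (Suc k)
  have "\<forall>x\<in>S. f differentiable (at x)"
    using Suc.prems by simp
  moreover have "Ck_on k S (\<lambda>x. frechet_derivative f (at x) v)" for v
    by (rule Suc.IH) (use Suc.prems in simp)
  ultimately show ?case by simp
qed

text \<open>\<open>frechet_derivative\<close> is a choice among all derivatives at the point. Both
  functions admit the same candidates, so the chosen values agree even where neither function is
  differentiable.\<close>

lemma frechet_derivative_cong_open:
  assumes "open S" "x \<in> S" "\<And>y. y \<in> S \<Longrightarrow> f y = g y"
  shows "frechet_derivative f (at x) = frechet_derivative g (at x)"
proof -
  have "(f has_derivative F) (at x) \<longleftrightarrow> (g has_derivative F) (at x)" for F
    by (rule iffI; erule has_derivative_transform_within_open[OF _ assms(1,2)]) (simp_all add: assms(3))
  then show ?thesis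
    by (simp add: frechet_derivative_def)
qed

lemma Ck_on_cong:
  assumes "open S" "\<And>y. y \<in> S \<Longrightarrow> f y = g y" "Ck_on k S f"
  shows "Ck_on k S g"
  using assms(2,3)
proof (induction k arbitrary: f g)
  case 0
  then show ?case by (simp cong: continuous_on_cong)
next
  case (Suc k)
  have "g differentiable (at x)" if x: "x \<in> S" for x
    using Suc.prems x assms(1) unfolding Ck_on.simps differentiable_def
    by (meson has_derivative_transform_within_open)
  moreover have "Ck_on k S (\<lambda>x. frechet_derivative g (at x) v)" for v
  proof (rule Suc.IH)
    show "Ck_on k S (\<lambda>x. frechet_derivative f (at x) v)"
      using Suc.prems(2) by simp
    show "frechet_derivative f (at x) v = frechet_derivative g (at x) v" if "x \<in> S" for x
      using frechet_derivative_cong_open[OF assms(1) that, of f g] Suc.prems(1) by simp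
  qed
  ultimately show ?case by simp
qed

text \<open>All derivatives are taken at points of the ambient space, so only values near each point
  count. This allows a function defined by cases to be checked on a different neighbourhood for each
  case.\<close>

lemma Ck_on_local:
  assumes "\<And>x. x \<in> S \<Longrightarrow> \<exists>T. open T \<and> x \<in> T \<and> Ck_on k T f"
  shows "Ck_on k S f"
  using assms
proof (induction k arbitrary: f)
  case 0
  have "isCont f x" if "x \<in> S" for x
    using 0[OF that] by (auto simp: continuous_on_eq_continuous_at)
  then show ?case
    by (simp add: continuous_at_imp_continuous_on)
next
  case (Suc k)
  have "f differentiable (at x)" if "x \<in> S" for x
    using Suc.prems[OF that] by auto
  moreover have "Ck_on k S (\<lambda>x. frechet_derivative f (at x) v)" for v
    by (rule Suc.IH) (use Suc.prems in fastforce)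
  ultimately show ?case by simp
qed

section \<open>Closure of class C^k under sums, products and composition\<close>

lemma Ck_on_const: "Ck_on k S (\<lambda>x. c)"
  by (induction k arbitrary: c) auto

lemma Ck_on_add:
  assumes "open S" "Ck_on k S f" "Ck_on k S g"
  shows "Ck_on k S (\<lambda>x. f x + g x)"
  using assms(2,3)
proof (induction k arbitrary: f g)
  case 0
  then show ?case by (auto intro: continuous_on_add)
next
  case (Suc k)
  have eq: "frechet_derivative (\<lambda>x. f x + g x) (at x) =
      (\<lambda>v. frechet_derivative f (at x) v + frechet_derivative g (at x) v)" if "x \<in> S" for x
    using Suc.prems that
    by (intro frechet_derivative_at[symmetric] has_derivative_add) (auto simp: frechet_derivative_works)
  have "Ck_on k S (\<lambda>x. frechet_derivative f (at x) v + frechet_derivative g (at x) v)" for v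
    by (rule Suc.IH) (use Suc.prems in simp_all)
  then have "Ck_on k S (\<lambda>x. frechet_derivative (\<lambda>x. f x + g x) (at x) v)" for v
    by (rule Ck_on_cong[OF assms(1), rotated]) (simp add: eq)
  then show ?case
    using Suc.prems by auto
qed

lemma Ck_on_sum:
  assumes "open S" "\<And>i. i \<in> I \<Longrightarrow> Ck_on k S (f i)"
  shows "Ck_on k S (\<lambda>x. \<Sum>i\<in>I. f i x)"
  using assms(2)
  by (induction I rule: infinite_finite_induct)
    (auto simp: Ck_on_const intro!: Ck_on_add assms(1))

lemma Ck_on_bounded_linear:
  assumes "open S" "bounded_linear L" "Ck_on k S f"
  shows "Ck_on k S (\<lambda>x. L (f x))"
  using assms(3)
proof (induction k arbitrary: f)
  case 0
  then show ?case
    using bounded_linear.continuous_on[OF assms(2)] by simp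
next
  case (Suc k)
  have der: "((\<lambda>x. L (f x)) has_derivative (\<lambda>v. L (frechet_derivative f (at x) v))) (at x)"
    if "x \<in> S" for x
    using Suc.prems that
    by (intro bounded_linear.has_derivative[OF assms(2)]) (auto simp: frechet_derivative_works)
  have "Ck_on k S (\<lambda>x. L (frechet_derivative f (at x) v))" for v
    by (rule Suc.IH) (use Suc.prems in simp)
  then have "Ck_on k S (\<lambda>x. frechet_derivative (\<lambda>x. L (f x)) (at x) v)" for v
    by (rule Ck_on_cong[OF assms(1), rotated]) (simp add: frechet_derivative_at[OF der, symmetric])
  then show ?case
    using der by (auto simp: differentiable_def)
qed

lemma Ck_on_mult:
  fixes f g :: "'a::real_normed_vector \<Rightarrow> real"
  assumes "open S" "Ck_on k S f" "Ck_on k S g"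
  shows "Ck_on k S (\<lambda>x. f x * g x)"
  using assms(2,3)
proof (induction k arbitrary: f g)
  case 0
  then show ?case by (auto intro: continuous_on_mult)
next
  case (Suc k)
  have der: "((\<lambda>x. f x * g x) has_derivative
      (\<lambda>v. f x * frechet_derivative g (at x) v + frechet_derivative f (at x) v * g x)) (at x)"
    if "x \<in> S" for x
    using Suc.prems that
    by (intro has_derivative_mult) (auto simp: frechet_derivative_works)
  have "Ck_on k S (\<lambda>x. f x * frechet_derivative g (at x) v + frechet_derivative f (at x) v * g x)" for v
    using Suc.prems Ck_on_Suc_imp[OF Suc.prems(1)] Ck_on_Suc_imp[OF Suc.prems(2)]
    by (intro Ck_on_add[OF assms(1)] Suc.IH) auto
  then have "Ck_on k S (\<lambda>x. frechet_derivative (\<lambda>x. f x * g x) (at x) v)" for v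
    by (rule Ck_on_cong[OF assms(1), rotated]) (simp add: frechet_derivative_at[OF der, symmetric])
  then show ?case
    using der by (auto simp: differentiable_def)
qed

lemma frechet_derivative_compose_apply:
  assumes "f differentiable (at x)" "h differentiable (at (f x))"
  shows "frechet_derivative (\<lambda>x. h (f x)) (at x) v =
    frechet_derivative h (at (f x)) (frechet_derivative f (at x) v)"
  using frechet_derivative_compose[OF assms] by (simp add: o_def)

text \<open>Expanding the chain rule in the standard basis turns each directional derivative into a
  sum of products of scalar functions: coordinates of the derivative of \<open>f\<close>, and
  partial derivatives of \<open>h\<close> composed with \<open>f\<close>. The induction varies
  \<open>h\<close> and keeps \<open>f\<close> fixed, so its hypothesis covers the second
  factor.\<close>

lemma Ck_on_compose:
  fixes f :: "'a::real_normed_vector \<Rightarrow> 'b::euclidean_space" and h :: "'b \<Rightarrow> real"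
  assumes "open S" "f ` S \<subseteq> T" "Ck_on k S f" "Ck_on k T h"
  shows "Ck_on k S (\<lambda>x. h (f x))"
  using assms(3,4)
proof (induction k arbitrary: h)
  case 0
  then show ?case
    using continuous_on_compose2[OF _ _ assms(2), of h] by simp
next
  case (Suc k)
  have d: "f differentiable (at x)" "h differentiable (at (f x))" if "x \<in> S" for x
    using Suc.prems that assms(2) by auto
  have expand: "frechet_derivative (\<lambda>x. h (f x)) (at x) v =
      (\<Sum>b\<in>Basis. (frechet_derivative f (at x) v \<bullet> b) * frechet_derivative h (at (f x)) b)"
    if "x \<in> S" for x v
  proof -
    note lin = linear_frechet_derivative[OF d(2)[OF that]]
    have "frechet_derivative h (at (f x)) (\<Sum>b\<in>Basis. (w \<bullet> b) *\<^sub>R b) =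
        (\<Sum>b\<in>Basis. (w \<bullet> b) * frechet_derivative h (at (f x)) b)" for w
      by (simp only: linear_sum[OF lin] linear_cmul[OF lin] real_scaleR_def)
    from this[of "frechet_derivative f (at x) v"] show ?thesis
      by (simp only: euclidean_representation frechet_derivative_compose_apply[OF d[OF that]])
  qed
  have "Ck_on k S (\<lambda>x. \<Sum>b\<in>Basis. (frechet_derivative f (at x) v \<bullet> b) * frechet_derivative h (at (f x)) b)" for v
  proof (rule Ck_on_sum[OF assms(1)], rule Ck_on_mult[OF assms(1)])
    fix b :: 'b
    show "Ck_on k S (\<lambda>x. frechet_derivative f (at x) v \<bullet> b)"
      by (rule Ck_on_bounded_linear[OF assms(1) bounded_linear_inner_left]) (use Suc.prems(1) in simp)
    show "Ck_on k S (\<lambda>x. frechet_derivative h (at (f x)) b)"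
      by (rule Suc.IH[OF Ck_on_Suc_imp[OF Suc.prems(1)]]) (use Suc.prems(2) in simp)
  qed
  then have "Ck_on k S (\<lambda>x. frechet_derivative (\<lambda>x. h (f x)) (at x) v)" for v
    by (rule Ck_on_cong[OF assms(1), rotated]) (simp add: expand)
  moreover have "(\<lambda>x. h (f x)) differentiable (at x)" if "x \<in> S" for x
    using differentiable_chain_at[OF d[OF that]] by (simp add: o_def)
  ultimately show ?case by simp
qed

section \<open>A function flat at 0 and smooth bump functions\<close>

text \<open>Polynomials in $1/t$ are carried along because these functions are closed under
  differentiation, which gives smoothness at $0$ by induction.\<close>

definition flat_exp :: "real poly \<Rightarrow> real \<Rightarrow> real" where
  "flat_exp p t = (if 0 < t then poly p (inverse t) * exp (- inverse t) else 0)"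

lemma poly_times_exp_minus_tendsto_0: "((\<lambda>s. poly p s * exp (- s)) \<longlongrightarrow> (0::real)) at_top"
proof -
  have "((\<lambda>s. \<Sum>i\<le>degree p. coeff p i * (s ^ i / exp s)) \<longlongrightarrow> (\<Sum>i\<le>degree p. coeff p i * 0)) at_top"
    by (intro tendsto_sum tendsto_mult tendsto_const tendsto_power_div_exp_0)
  moreover have "poly p s * exp (- s) = (\<Sum>i\<le>degree p. coeff p i * (s ^ i / exp s))" for s
    by (simp add: poly_altdef sum_distrib_right exp_minus divide_inverse mult.assoc)
  ultimately show ?thesis by simp
qed

text \<open>With s = 1/t, so that ds/dt = - s^2, the derivative of p(s) exp(-s) in t is s^2 (p(s) -
  p'(s)) exp(-s).\<close>

definition flat_exp_deriv :: "real poly \<Rightarrow> real poly" where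
  "flat_exp_deriv p = monom 1 2 * (p - pderiv p)"

lemma flat_exp_has_derivative:
  "(flat_exp p has_real_derivative flat_exp (flat_exp_deriv p) t) (at t)"
proof (cases t "0::real" rule: linorder_cases)
  case less
  have "((\<lambda>t. 0) has_real_derivative 0) (at t)"
    by simp
  then show ?thesis
    using less
    by (subst has_field_derivative_cong_eventually[where g="\<lambda>t. 0"])
      (auto simp: flat_exp_def intro!: eventually_mono[OF eventually_at_in_open[of "{..<0}" t]])
next
  case greater
  have "((\<lambda>t. poly p (inverse t) * exp (- inverse t)) has_real_derivative
      flat_exp (flat_exp_deriv p) t) (at t)"
    using greater
    by (auto intro!: derivative_eq_intros DERIV_chain2[OF poly_DERIV] simp: flat_exp_def flat_exp_deriv_def poly_monom
        field_simps power2_eq_square)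
  then show ?thesis
    using greater
    by (subst has_field_derivative_cong_eventually[where g="\<lambda>t. poly p (inverse t) * exp (- inverse t)"])
      (auto simp: flat_exp_def intro!: eventually_mono[OF eventually_at_in_open[of "{0<..}" t]])
next
  case equal
  \<comment> \<open>Dividing by t means multiplying the polynomial by its variable 1/t, which is
    what \<open>pCons 0\<close> does. The difference quotient at 0 from the right is thus again a
    polynomial in 1/t times the exponential, and 1/t tends to infinity.\<close>
  have "((\<lambda>t. poly (pCons 0 p) (inverse t) * exp (- inverse t)) \<longlongrightarrow> 0) (at_right (0::real))"
    by (rule filterlim_compose[OF poly_times_exp_minus_tendsto_0 filterlim_inverse_at_top_right])
  then have "((\<lambda>t. flat_exp p t / t) \<longlongrightarrow> 0) (at_right 0)"
    by (rule Lim_transform_eventually)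
      (auto simp: flat_exp_def field_simps intro!: eventually_at_rightI[of 0 1])
  moreover have "((\<lambda>t. flat_exp p t / t) \<longlongrightarrow> 0) (at_left 0)"
    by (rule Lim_transform_eventually[OF tendsto_const])
      (auto simp: flat_exp_def intro!: eventually_at_leftI[of "-1" 0])
  ultimately have "((\<lambda>t. flat_exp p t / t) \<longlongrightarrow> 0) (at 0)"
    by (rule filterlim_split_at[rotated])
  then show ?thesis
    using equal by (simp add: has_field_derivative_iff flat_exp_def)
qed

lemma smooth_on_flat_exp: "smooth_on S (flat_exp p)"
proof -
  have "Ck_on k S (flat_exp p)" for k
  proof (induction k arbitrary: p)
    case 0
    then show ?case
      using flat_exp_has_derivative
      by (auto intro!: continuous_at_imp_continuous_on DERIV_isCont)
  next
    case (Suc k)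
    have "frechet_derivative (flat_exp p) (at t) v = flat_exp (flat_exp_deriv p) t * v" for t v
      by (simp add: frechet_derivative_at[OF flat_exp_has_derivative[of p t, unfolded has_field_derivative_def], symmetric])
    \<comment> \<open>Absorbing the direction \<open>v\<close> into the polynomial keeps the
      derivative within the family over which the induction is generalised.\<close>
    then have "frechet_derivative (flat_exp p) (at t) v = flat_exp (smult v (flat_exp_deriv p)) t" for t v
      by (simp add: flat_exp_def)
    moreover have "flat_exp p differentiable (at t)" for t
      using flat_exp_has_derivative[of p t] by (auto simp: differentiable_def has_field_derivative_def)
    ultimately show ?case
      using Suc.IH by simp
  qed
  then show ?thesis
    by (simp add: smooth_on_def)
qed

text \<open>The function is exp(-1/t) at t = r^2 - |x - x0|^2, continued by 0 for t \<le> 0 and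
  divided by its value \<open>c\<close> at the centre. The squared norm is spelled out in
  coordinates so that the rules for sums and products give its smoothness.\<close>

lemma smooth_bump_exists:
  fixes x0 :: "'a::euclidean_space"
  assumes "r > 0"
  obtains b :: "'a \<Rightarrow> real"
  where "\<And>S. open S \<Longrightarrow> smooth_on S b" "b x0 = 1" "\<And>x. x \<notin> cball x0 r \<Longrightarrow> b x = 0"
proof
  define c where "c = flat_exp 1 (r\<^sup>2)"
  define b where "b x = inverse c * flat_exp 1 (r\<^sup>2 - (\<Sum>i\<in>Basis. ((x - x0) \<bullet> i) * ((x - x0) \<bullet> i)))" for x
  have id: "Ck_on k S (\<lambda>x::'a. x)" for k S
    by (cases k) (auto simp: Ck_on_const)
  have c: "c \<noteq> 0"
    using assms by (simp add: c_def flat_exp_def)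
  have norm: "(\<Sum>i\<in>Basis. (y \<bullet> i) * (y \<bullet> i)) = (norm y)\<^sup>2" for y :: 'a
    by (simp add: euclidean_inner[symmetric] power2_norm_eq_inner)
  show "smooth_on S b" if "open S" for S
    unfolding smooth_on_def b_def
  proof
    fix k
    have lin: "Ck_on k S (\<lambda>x. (x - x0) \<bullet> i)" for i
      using Ck_on_bounded_linear[OF that bounded_linear_inner_left[of i] Ck_on_add[OF that id Ck_on_const[of k S "- x0"]]]
      by simp
    have "Ck_on k S (\<lambda>x. r\<^sup>2 + (- 1) * (\<Sum>i\<in>Basis. ((x - x0) \<bullet> i) * ((x - x0) \<bullet> i)))"
      by (rule Ck_on_add[OF that Ck_on_const]) (rule Ck_on_mult[OF that Ck_on_const], rule Ck_on_sum[OF that],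
          rule Ck_on_mult[OF that lin lin])
    then have "Ck_on k S (\<lambda>x. r\<^sup>2 - (\<Sum>i\<in>Basis. ((x - x0) \<bullet> i) * ((x - x0) \<bullet> i)))"
      by simp
    moreover have "Ck_on k UNIV (flat_exp 1)"
      using smooth_on_flat_exp[of UNIV 1] by (simp add: smooth_on_def)
    ultimately have "Ck_on k S (\<lambda>x. flat_exp 1 (r\<^sup>2 - (\<Sum>i\<in>Basis. ((x - x0) \<bullet> i) * ((x - x0) \<bullet> i))))"
      by (rule Ck_on_compose[OF that subset_UNIV])
    then show "Ck_on k S (\<lambda>x. inverse c * flat_exp 1 (r\<^sup>2 - (\<Sum>i\<in>Basis. ((x - x0) \<bullet> i) * ((x - x0) \<bullet> i))))"
      by (rule Ck_on_mult[OF that Ck_on_const])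
  qed
  show "b x0 = 1"
    using c by (simp add: b_def c_def)
  show "b x = 0" if "x \<notin> cball x0 r" for x
  proof -
    have "r\<^sup>2 \<le> (norm (x - x0))\<^sup>2"
      using that assms by (intro power_mono) (auto simp: dist_norm norm_minus_commute)
    then show ?thesis
      by (simp add: b_def norm flat_exp_def)
  qed
qed


subsection \<open>Tangent spaces and vector fields\<close>

locale smooth_manifold =
  fixes \<A> :: "('m::{t2_space,second_countable_topology}, 'e::euclidean_space) chart set"
  assumes atlas: "smooth_atlas \<A>"
begin

section \<open>Charts and smooth functions on the manifold\<close>

lemma chart_cover: "\<exists>U \<psi>. (U, \<psi>) \<in> \<A> \<and> q \<in> U"
proof -
  have "q \<in> (\<Union>(U, \<psi>)\<in>\<A>. U)"
    using atlas unfolding smooth_atlas_def by blast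
  then show ?thesis by auto
qed

lemma chart_open:
  assumes "(U, \<psi>) \<in> \<A>"
  shows "open U" "open (\<psi> ` U)"
  using atlas assms unfolding smooth_atlas_def is_chart_def by fast+

lemma chart_homeomorphism:
  assumes "(U, \<psi>) \<in> \<A>"
  obtains \<psi>' where "homeomorphism U (\<psi> ` U) \<psi> \<psi>'"
  using atlas assms unfolding smooth_atlas_def is_chart_def by fast

lemma chart_inj: "(U, \<psi>) \<in> \<A> \<Longrightarrow> inj_on \<psi> U"
  by (erule chart_homeomorphism) (auto simp: homeomorphism_def intro: inj_on_inverseI)

lemma inv_chart [simp]: "(U, \<psi>) \<in> \<A> \<Longrightarrow> r \<in> U \<Longrightarrow> inv_into U \<psi> (\<psi> r) = r"
  using chart_inj by (rule inv_into_f_f)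

text \<open>The inverse supplied by the homeomorphism agrees on the image with
  \<open>inv_into\<close>, in terms of which smoothness is defined.\<close>

lemma chart_continuous_inv:
  assumes "(U, \<psi>) \<in> \<A>"
  shows "continuous_on (\<psi> ` U) (inv_into U \<psi>)"
proof -
  obtain \<psi>' where h: "homeomorphism U (\<psi> ` U) \<psi> \<psi>'"
    using chart_homeomorphism[OF assms] .
  then have "continuous_on (\<psi> ` U) \<psi>'" and "\<And>r. r \<in> U \<Longrightarrow> \<psi>' (\<psi> r) = r"
    by (auto simp: homeomorphism_def)
  then show ?thesis
    using assms by (subst continuous_on_cong[where g=\<psi>']) auto
qed

lemma chart_open_image:
  assumes "(U, \<psi>) \<in> \<A>" "open W" "W \<subseteq> U"
  shows "open (\<psi> ` W)"
proof -
  have "\<psi> ` W = \<psi> ` U \<inter> inv_into U \<psi> -` W"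
    using assms by force
  then show ?thesis
    using continuous_open_preimage[OF chart_continuous_inv chart_open(2)] assms by simp
qed

lemma transition_Ck:
  assumes "(U, \<psi>) \<in> \<A>" "(V, \<theta>) \<in> \<A>"
  shows "Ck_on k (\<psi> ` (U \<inter> V)) (\<lambda>x. \<theta> (inv_into U \<psi> x))"
  using atlas assms unfolding smooth_atlas_def smooth_on_def by (fastforce simp: o_def)

lemma smooth_function_Ck:
  "f \<in> smooth_functions \<A> \<Longrightarrow> (U, \<psi>) \<in> \<A> \<Longrightarrow> Ck_on k (\<psi> ` U) (\<lambda>x. f (inv_into U \<psi> x))"
  unfolding smooth_functions_def smooth_on_def by (fastforce simp: o_def)

lemma smooth_functionI:
  "(\<And>U \<psi> k. (U, \<psi>) \<in> \<A> \<Longrightarrow> Ck_on k (\<psi> ` U) (\<lambda>x. f (inv_into U \<psi> x))) \<Longrightarrow> f \<in> smooth_functions \<A>"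
  unfolding smooth_functions_def smooth_on_def by (auto simp: o_def)

lemma smooth_function_differentiable:
  assumes "f \<in> smooth_functions \<A>" "(U, \<psi>) \<in> \<A>" "q \<in> U"
  shows "(\<lambda>x. f (inv_into U \<psi> x)) differentiable (at (\<psi> q))"
  using smooth_function_Ck[OF assms(1,2), of "Suc 0"] assms(3) by simp

lemma smooth_function_const: "(\<lambda>q. c) \<in> smooth_functions \<A>"
  by (rule smooth_functionI) (rule Ck_on_const)

lemma smooth_function_add:
  "f \<in> smooth_functions \<A> \<Longrightarrow> h \<in> smooth_functions \<A> \<Longrightarrow> (\<lambda>q. f q + h q) \<in> smooth_functions \<A>"
  by (rule smooth_functionI) (rule Ck_on_add[OF chart_open(2)]; simp add: smooth_function_Ck)

lemma smooth_function_mult: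
  "f \<in> smooth_functions \<A> \<Longrightarrow> h \<in> smooth_functions \<A> \<Longrightarrow> (\<lambda>q. f q * h q) \<in> smooth_functions \<A>"
  by (rule smooth_functionI) (rule Ck_on_mult[OF chart_open(2)]; simp add: smooth_function_Ck)

text \<open>A point of \<open>U\<close> has a neighbourhood inside \<open>U\<close>, where the
  transition map reduces the claim to smoothness of \<open>h\<close>. A point outside
  \<open>U\<close> has a neighbourhood on which the function is 0, because the part of the manifold
  corresponding to \<open>K\<close> is compact, hence closed in a Hausdorff space.\<close>

lemma smooth_function_extend:
  assumes c: "(U, \<psi>) \<in> \<A>" and h: "smooth_on (\<psi> ` U) h"
    and K: "compact K" "K \<subseteq> \<psi> ` U" "\<And>x. x \<notin> K \<Longrightarrow> h x = 0"
  shows "(\<lambda>r. if r \<in> U then h (\<psi> r) else 0) \<in> smooth_functions \<A>"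
proof (rule smooth_functionI, rule Ck_on_local)
  fix V \<theta> k x
  assume d: "(V, \<theta>) \<in> \<A>" and "x \<in> \<theta> ` V"
  then obtain r where r: "r \<in> V" "x = \<theta> r" by auto
  define f where "f = (\<lambda>x. if inv_into V \<theta> x \<in> U then h (\<psi> (inv_into V \<theta> x)) else 0)"
  show "\<exists>T. open T \<and> x \<in> T \<and> Ck_on k T (\<lambda>x. if inv_into V \<theta> x \<in> U then h (\<psi> (inv_into V \<theta> x)) else 0)"
    unfolding f_def[symmetric]
  proof (cases "r \<in> U")
    case True
    let ?T = "\<theta> ` (V \<inter> U)"
    have T: "open ?T"
      using chart_open_image[OF d, of "V \<inter> U"] chart_open(1)[OF c] chart_open(1)[OF d] by auto
    have "Ck_on k ?T (\<lambda>x. h (\<psi> (inv_into V \<theta> x)))"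
      by (rule Ck_on_compose[OF T _ transition_Ck[OF d c], where T="\<psi> ` U"])
        (use d h in \<open>auto simp: smooth_on_def\<close>)
    then have "Ck_on k ?T f"
      by (rule Ck_on_cong[OF T, rotated]) (use d in \<open>auto simp: f_def\<close>)
    then show "\<exists>T. open T \<and> x \<in> T \<and> Ck_on k T f"
      using T True r by blast
  next
    case False
    let ?K = "inv_into U \<psi> ` K" and ?T = "\<theta> ` (V - inv_into U \<psi> ` K)"
    have "compact ?K"
      using compact_continuous_image[OF continuous_on_subset[OF chart_continuous_inv[OF c] K(2)] K(1)] .
    then have T: "open ?T"
      using chart_open_image[OF d, of "V - ?K"] chart_open(1)[OF d] by (auto intro: compact_imp_closed)
    have "f y = 0" if "y \<in> ?T" for y
    proof -
      obtain s where s: "s \<in> V" "s \<notin> ?K" "y = \<theta> s"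
        using \<open>y \<in> ?T\<close> by auto
      then have "\<psi> s \<notin> K" if "s \<in> U"
        using inv_chart[OF c that] by (metis imageI)
      then show ?thesis
        using s K(3) d by (auto simp: f_def)
    qed
    then have "Ck_on k ?T f"
      by (intro Ck_on_cong[OF T _ Ck_on_const[of _ _ 0]]) simp
    moreover have "x \<in> ?T"
      using False r K(2) c by (auto intro!: imageI)
    ultimately show "\<exists>T. open T \<and> x \<in> T \<and> Ck_on k T f"
      using T by blast
  qed
qed

section \<open>Tangent spaces in a chart\<close>

lemma coord_tangent_change:
  assumes c: "(U, \<psi>) \<in> \<A>" and d: "(V, \<theta>) \<in> \<A>" and q: "q \<in> U" "q \<in> V"
  shows "coord_tangent \<A> (V, \<theta>) q w =
    coord_tangent \<A> (U, \<psi>) q (frechet_derivative (\<lambda>x. \<psi> (inv_into V \<theta> x)) (at (\<theta> q)) w)"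
proof -
  let ?T = "\<theta> ` (V \<inter> U)" and ?t = "\<lambda>x. \<psi> (inv_into V \<theta> x)"
  have T: "open ?T"
    using chart_open_image[OF d, of "V \<inter> U"] chart_open(1)[OF c] chart_open(1)[OF d] by auto
  have x: "\<theta> q \<in> ?T" using q by auto
  have t: "?t differentiable (at (\<theta> q))"
    using transition_Ck[OF d c, of "Suc 0"] q by simp
  have "frechet_derivative (\<lambda>x. f (inv_into V \<theta> x)) (at (\<theta> q)) w =
      frechet_derivative (\<lambda>x. f (inv_into U \<psi> x)) (at (\<psi> q)) (frechet_derivative ?t (at (\<theta> q)) w)"
    if f: "f \<in> smooth_functions \<A>" for f
  proof -
    \<comment> \<open>On the overlap, \<open>f\<close> in the chart \<theta> is \<open>f\<close> in
      the chart \<psi> after the transition map \<open>?t\<close>, and the chain rule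
      applies.\<close>
    have "frechet_derivative (\<lambda>x. f (inv_into V \<theta> x)) (at (\<theta> q)) =
        frechet_derivative (\<lambda>x. f (inv_into U \<psi> (?t x))) (at (\<theta> q))"
      by (rule frechet_derivative_cong_open[OF T x]) (use c d in auto)
    then show ?thesis
      using frechet_derivative_compose_apply[OF t, of "\<lambda>x. f (inv_into U \<psi> x)" w]
        smooth_function_differentiable[OF f c q(1)] d q by simp
  qed
  then show ?thesis
    by (auto simp: coord_tangent_def o_def fun_eq_iff)
qed

text \<open>By the change of coordinates, vectors coming from other charts are already given by this
  one. Linear operations on tangent vectors can therefore be carried out in a single chart, where
  they are operations on coordinate vectors.\<close>

lemma tangent_space_chart:
  assumes c: "(U, \<psi>) \<in> \<A>" and q: "q \<in> U"
  shows "tangent_space \<A> q = range (coord_tangent \<A> (U, \<psi>) q)"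
proof -
  have "coord_tangent \<A> d q w \<in> range (coord_tangent \<A> (U, \<psi>) q)" if "d \<in> \<A>" "q \<in> fst d" for d w
    using coord_tangent_change[OF c, of "fst d" "snd d" q w] that q by auto
  then show ?thesis
    using assms unfolding tangent_space_def by fastforce
qed

lemma coord_tangent_add:
  assumes "(U, \<psi>) \<in> \<A>" "q \<in> U"
  shows "coord_tangent \<A> (U, \<psi>) q (u + v) = coord_tangent \<A> (U, \<psi>) q u + coord_tangent \<A> (U, \<psi>) q v"
  using linear_add[OF linear_frechet_derivative[OF smooth_function_differentiable[OF _ assms]]]
  by (auto simp: coord_tangent_def fun_eq_iff o_def)

lemma coord_tangent_scale:
  assumes "(U, \<psi>) \<in> \<A>" "q \<in> U"
  shows "coord_tangent \<A> (U, \<psi>) q (a *\<^sub>R u) = (\<lambda>h. a * coord_tangent \<A> (U, \<psi>) q u h)"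
  using linear_cmul[OF linear_frechet_derivative[OF smooth_function_differentiable[OF _ assms]]]
  by (auto simp: coord_tangent_def fun_eq_iff o_def)

lemma tangent_space_add:
  assumes "v \<in> tangent_space \<A> q" "w \<in> tangent_space \<A> q"
  shows "v + w \<in> tangent_space \<A> q"
proof -
  obtain U \<psi> where c: "(U, \<psi>) \<in> \<A>" "q \<in> U"
    using chart_cover by blast
  show ?thesis
    using assms coord_tangent_add[OF c, symmetric] by (auto simp: tangent_space_chart[OF c])
qed

lemma tangent_space_scale:
  assumes "v \<in> tangent_space \<A> q"
  shows "(\<lambda>h. a * v h) \<in> tangent_space \<A> q"
proof -
  obtain U \<psi> where c: "(U, \<psi>) \<in> \<A>" "q \<in> U"
    using chart_cover by blast
  show ?thesis
    using assms coord_tangent_scale[OF c, symmetric] by (auto simp: tangent_space_chart[OF c])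
qed

lemma tangent_space_uminus: "v \<in> tangent_space \<A> q \<Longrightarrow> - v \<in> tangent_space \<A> q"
  using tangent_space_scale[of v q "- 1"] by (simp add: fun_Compl_def)

lemma tangent_space_diff: "v \<in> tangent_space \<A> q \<Longrightarrow> w \<in> tangent_space \<A> q \<Longrightarrow> v - w \<in> tangent_space \<A> q"
  using tangent_space_add[OF _ tangent_space_uminus, of v q w] by simp

lemma tangent_space_zero: "0 \<in> tangent_space \<A> q"
proof -
  obtain U \<psi> where c: "(U, \<psi>) \<in> \<A>" "q \<in> U"
    using chart_cover by blast
  have "coord_tangent \<A> (U, \<psi>) q (0 *\<^sub>R 0) = 0"
    unfolding coord_tangent_scale[OF c] by (simp add: zero_fun_def)
  then show ?thesis
    unfolding tangent_space_chart[OF c] by (metis rangeI)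
qed

section \<open>Vector fields and the extension of tangent vectors\<close>

lemma vector_fieldD:
  assumes "X \<in> vector_fields \<A>"
  shows "X q \<in> tangent_space \<A> q" "f \<in> smooth_functions \<A> \<Longrightarrow> (\<lambda>q. X q f) \<in> smooth_functions \<A>"
  using assms by (auto simp: vector_fields_def)

lemma vector_field_add: "X \<in> vector_fields \<A> \<Longrightarrow> Y \<in> vector_fields \<A> \<Longrightarrow> X + Y \<in> vector_fields \<A>"
  by (simp add: vector_fields_def tangent_space_add smooth_function_add)

lemma vector_field_fscale:
  "f \<in> smooth_functions \<A> \<Longrightarrow> X \<in> vector_fields \<A> \<Longrightarrow> f \<odot> X \<in> vector_fields \<A>"
  by (simp add: vector_fields_def fscale_def tangent_space_scale smooth_function_mult)

lemma vector_field_uminus: "X \<in> vector_fields \<A> \<Longrightarrow> - X \<in> vector_fields \<A>"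
  using vector_field_fscale[OF smooth_function_const[of "- 1"], of X]
  by (simp add: fscale_def fun_Compl_def)

lemma vector_field_diff: "X \<in> vector_fields \<A> \<Longrightarrow> Y \<in> vector_fields \<A> \<Longrightarrow> X - Y \<in> vector_fields \<A>"
  using vector_field_add[OF _ vector_field_uminus, of X Y] by simp

text \<open>Used to differentiate the constant function \<eta>(\<xi>) = 1.\<close>

lemma tangent_const:
  assumes "v \<in> tangent_space \<A> q"
  shows "v (\<lambda>r. c) = 0"
  using assms by (auto simp: tangent_space_def coord_tangent_def o_def split: prod.splits)

text \<open>The field has constant coordinates \<open>u\<close> multiplied by a bump function that
  is 1 at \<psi>(q). Applied to a smooth function it gives the bump times a directional derivative
  in the chart. This vanishes outside a closed ball inside the coordinate image, so it extends
  smoothly by 0.\<close>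

lemma vector_field_through:
  assumes "v \<in> tangent_space \<A> q"
  obtains X where "X \<in> vector_fields \<A>" "X q = v"
proof -
  obtain U \<psi> where c: "(U, \<psi>) \<in> \<A>" "q \<in> U"
    using chart_cover by blast
  obtain u where u: "v = coord_tangent \<A> (U, \<psi>) q u"
    using assms tangent_space_chart[OF c] by auto
  obtain r where r: "r > 0" "cball (\<psi> q) r \<subseteq> \<psi> ` U"
    using chart_open(2)[OF c(1)] c(2) open_contains_cball by blast
  obtain b :: "'e \<Rightarrow> real" where b: "\<And>S. open S \<Longrightarrow> smooth_on S b" "b (\<psi> q) = 1"
    "\<And>x. x \<notin> cball (\<psi> q) r \<Longrightarrow> b x = 0"
    using smooth_bump_exists[OF r(1)] by metis
  define X where "X p = (if p \<in> U then coord_tangent \<A> (U, \<psi>) p (b (\<psi> p) *\<^sub>R u) else 0)" for p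
  have "X p \<in> tangent_space \<A> p" for p
    using tangent_space_chart[OF c(1)] tangent_space_zero by (auto simp: X_def)
  moreover have "(\<lambda>p. X p f) \<in> smooth_functions \<A>" if f: "f \<in> smooth_functions \<A>" for f
  proof -
    have "smooth_on (\<psi> ` U) (\<lambda>x. b x * frechet_derivative (\<lambda>x. f (inv_into U \<psi> x)) (at x) u)"
      unfolding smooth_on_def
    proof
      fix k
      have "Ck_on k (\<psi> ` U) (\<lambda>x. frechet_derivative (\<lambda>x. f (inv_into U \<psi> x)) (at x) u)"
        using smooth_function_Ck[OF f c(1), of "Suc k"] by simp
      moreover have "Ck_on k (\<psi> ` U) b"
        using b(1)[OF chart_open(2)[OF c(1)]] by (simp add: smooth_on_def)
      ultimately show "Ck_on k (\<psi> ` U) (\<lambda>x. b x * frechet_derivative (\<lambda>x. f (inv_into U \<psi> x)) (at x) u)"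
        by (intro Ck_on_mult chart_open(2)[OF c(1)])
    qed
    then have "(\<lambda>p. if p \<in> U then b (\<psi> p) * frechet_derivative (\<lambda>x. f (inv_into U \<psi> x)) (at (\<psi> p)) u else 0)
        \<in> smooth_functions \<A>"
      by (rule smooth_function_extend[OF c(1) _ compact_cball r(2)]) (simp add: b(3))
    moreover have "X p f = (if p \<in> U then b (\<psi> p) * frechet_derivative (\<lambda>x. f (inv_into U \<psi> x)) (at (\<psi> p)) u else 0)" for p
      unfolding X_def using f by (simp add: coord_tangent_scale[OF c(1)]) (simp add: coord_tangent_def o_def)
    ultimately show ?thesis by simp
  qed
  ultimately have "X \<in> vector_fields \<A>"
    by (simp add: vector_fields_def)
  moreover have "X q = v"
    using c b(2) u by (simp add: X_def)
  ultimately show ?thesis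
    using that by blast
qed

end


subsection \<open>The tensors of an almost contact structure with Norden metric\<close>

lemma fscale_apply: "(f \<odot> X) q = (\<lambda>h. f q * X q h)"
  by (simp add: fscale_def)

lemma endo_app_apply: "(\<phi> \<bullet>\<^sub>e X) q = \<phi> q (X q)"
  by (simp add: endo_app_def)

lemma uminus_eq_scale: "- (v :: 'a \<Rightarrow> real) = (\<lambda>h. (- 1) * v h)"
  by (simp add: fun_Compl_def)

locale almost_contact_norden_manifold = smooth_manifold \<A>
  for \<A> :: "('m::{t2_space,second_countable_topology}, 'e::euclidean_space) chart set" +
  fixes \<phi> :: "'m endo" and \<xi> :: "'m vfield" and \<eta> :: "'m form" and g :: "'m bilin"
    and D :: "'m vfield \<Rightarrow> 'm vfield \<Rightarrow> 'm vfield"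
  assumes acn: "almost_contact_norden \<A> \<phi> \<xi> \<eta> g"
    and lc: "levi_civita \<A> g D"
begin

abbreviation "T \<equiv> tangent_space \<A>"
abbreviation "V \<equiv> vector_fields \<A>"
abbreviation "F \<equiv> fundamental_tensor \<phi> g D"
abbreviation "N \<equiv> nijenhuis_tensor \<phi> \<xi> \<eta> g D"
abbreviation "A \<equiv> cov_form D \<eta>"

declare vector_fieldD(1) [simp] tangent_space_add [simp] tangent_space_scale [simp]
  tangent_space_uminus [simp] tangent_space_diff [simp] tangent_space_zero [simp]
  vector_field_add [simp] vector_field_uminus [simp] vector_field_diff [simp]
  vector_field_fscale [simp] smooth_function_const [simp]

section \<open>Pointwise algebra of \<phi>, \<xi>, \<eta> and g\<close>

lemma endo: "tangent_endomorphism \<A> \<phi>"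
  and form: "one_form \<A> \<eta>"
  and metric: "pseudo_riemannian_metric \<A> g"
  and xi_field [simp]: "\<xi> \<in> V"
  and eta_xi [simp]: "\<eta> q (\<xi> q) = 1"
  and phi_phi_field: "X \<in> V \<Longrightarrow> \<phi> \<bullet>\<^sub>e \<phi> \<bullet>\<^sub>e X = (\<lambda>q. \<eta> q (X q)) \<odot> \<xi> - X"
  using acn by (simp_all add: almost_contact_norden_def)

lemma phi_tangent [simp]: "v \<in> T q \<Longrightarrow> \<phi> q v \<in> T q"
  and phi_add: "v \<in> T q \<Longrightarrow> w \<in> T q \<Longrightarrow> \<phi> q (v + w) = \<phi> q v + \<phi> q w"
  and phi_scale: "v \<in> T q \<Longrightarrow> \<phi> q (\<lambda>h. c * v h) = (\<lambda>h. c * \<phi> q v h)"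
  and phi_field [simp]: "X \<in> V \<Longrightarrow> \<phi> \<bullet>\<^sub>e X \<in> V"
  using endo by (simp_all add: tangent_endomorphism_def)

lemma phi_uminus: "v \<in> T q \<Longrightarrow> \<phi> q (- v) = - \<phi> q v"
  using phi_scale[of v q "- 1"] by (simp add: uminus_eq_scale)

lemma phi_diff: "v \<in> T q \<Longrightarrow> w \<in> T q \<Longrightarrow> \<phi> q (v - w) = \<phi> q v - \<phi> q w"
  using phi_add[of v q "- w"] by (simp add: phi_uminus)

lemma phi_zero: "\<phi> q 0 = 0"
  using phi_diff[of 0 q 0] by simp

lemma eta_add: "v \<in> T q \<Longrightarrow> w \<in> T q \<Longrightarrow> \<eta> q (v + w) = \<eta> q v + \<eta> q w"
  and eta_scale: "v \<in> T q \<Longrightarrow> \<eta> q (\<lambda>h. c * v h) = c * \<eta> q v"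
  and eta_smooth [simp]: "X \<in> V \<Longrightarrow> (\<lambda>q. \<eta> q (X q)) \<in> smooth_functions \<A>"
  using form by (simp_all add: one_form_def)

lemma eta_zero: "\<eta> q 0 = 0"
  using eta_add[of 0 q 0] by simp

lemma g_sym: "v \<in> T q \<Longrightarrow> w \<in> T q \<Longrightarrow> g q v w = g q w v"
  and g_add_left: "u \<in> T q \<Longrightarrow> v \<in> T q \<Longrightarrow> w \<in> T q \<Longrightarrow> g q (u + v) w = g q u w + g q v w"
  and g_scale_left: "v \<in> T q \<Longrightarrow> w \<in> T q \<Longrightarrow> g q (\<lambda>h. c * v h) w = c * g q v w"
  and g_nondegenerate: "v \<in> T q \<Longrightarrow> (\<And>w. w \<in> T q \<Longrightarrow> g q v w = 0) \<Longrightarrow> v = 0"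
  using metric by (auto simp: pseudo_riemannian_metric_def)

lemma g_uminus_left: "v \<in> T q \<Longrightarrow> w \<in> T q \<Longrightarrow> g q (- v) w = - g q v w"
  using g_scale_left[of v q w "- 1"] by (simp add: uminus_eq_scale)

lemma g_diff_left: "u \<in> T q \<Longrightarrow> v \<in> T q \<Longrightarrow> w \<in> T q \<Longrightarrow> g q (u - v) w = g q u w - g q v w"
  using g_add_left[of u q "- v" w] by (simp add: g_uminus_left)

lemma g_zero_left: "w \<in> T q \<Longrightarrow> g q 0 w = 0"
  using g_diff_left[of 0 q 0 w] by simp

lemma g_add_right: "u \<in> T q \<Longrightarrow> v \<in> T q \<Longrightarrow> w \<in> T q \<Longrightarrow> g q w (u + v) = g q w u + g q w v"
  using g_add_left g_sym by (metis tangent_space_add)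

lemma g_scale_right: "v \<in> T q \<Longrightarrow> w \<in> T q \<Longrightarrow> g q w (\<lambda>h. c * v h) = c * g q w v"
  using g_scale_left g_sym by (metis tangent_space_scale)

lemma g_uminus_right: "v \<in> T q \<Longrightarrow> w \<in> T q \<Longrightarrow> g q w (- v) = - g q w v"
  using g_uminus_left g_sym by (metis tangent_space_uminus)

lemma g_zero_right: "w \<in> T q \<Longrightarrow> g q w 0 = 0"
  using g_zero_left g_sym by (metis tangent_space_zero)

lemmas g_linear = g_add_left g_scale_left g_uminus_left g_diff_left g_zero_left
  g_add_right g_scale_right g_uminus_right g_zero_right

text \<open>Nondegeneracy tests against tangent vectors, whereas the connection is described by
  pairing with vector fields; \<open>vector_field_through\<close> passes from one to the
  other.\<close>

lemma tangent_eqI: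
  assumes "v \<in> T q" "w \<in> T q" "\<And>Z. Z \<in> V \<Longrightarrow> g q v (Z q) = g q w (Z q)"
  shows "v = w"
proof -
  have "g q (v - w) u = 0" if u: "u \<in> T q" for u
  proof -
    obtain Z where "Z \<in> V" "Z q = u"
      using vector_field_through[OF u] .
    then show ?thesis
      using assms(3)[of Z] assms(1,2) u by (simp add: g_diff_left)
  qed
  then have "v - w = 0"
    using assms(1,2) by (intro g_nondegenerate[of "v - w" q]) simp_all
  then show ?thesis by simp
qed

text \<open>The structure equation is assumed for fields; extending \<open>v\<close> to a field
  makes it an identity on each tangent space.\<close>

lemma phi_phi:
  assumes "v \<in> T q"
  shows "\<phi> q (\<phi> q v) = (\<lambda>h. \<eta> q v * \<xi> q h) - v"
proof -
  obtain X where "X \<in> V" "X q = v"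
    using vector_field_through[OF assms] .
  then show ?thesis
    using fun_cong[OF phi_phi_field, of X q] by (simp add: endo_app_apply fscale_apply)
qed

lemma g_phi_phi:
  assumes v: "v \<in> T q" and w: "w \<in> T q"
  shows "g q (\<phi> q v) (\<phi> q w) = - g q v w + \<eta> q v * \<eta> q w"
proof -
  obtain X Y where X: "X \<in> V" "X q = v" and Y: "Y \<in> V" "Y q = w"
    using vector_field_through[OF v] vector_field_through[OF w] by metis
  have "g q (\<phi> q (X q)) (\<phi> q (Y q)) = - g q (X q) (Y q) + \<eta> q (X q) * \<eta> q (Y q)"
    using acn X(1) Y(1) unfolding almost_contact_norden_def by blast
  then show ?thesis
    using X(2) Y(2) by simp
qed

lemma xi_nonzero: "\<xi> q \<noteq> 0"
  using eta_xi[of q] eta_zero[of q] by (metis zero_neq_one)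

text \<open>From \<phi>^2 \<xi> = 0, evaluating \<phi>^2 on \<phi>(\<xi>) gives \<phi>(\<xi>) = c
  \<xi> with c = \<eta>(\<phi>(\<xi>)). Applying \<phi> and then \<eta> once more gives c^2 =
  0.\<close>

lemma phi_xi [simp]: "\<phi> q (\<xi> q) = 0"
proof -
  have pp: "\<phi> q (\<phi> q (\<xi> q)) = 0"
    using phi_phi[of "\<xi> q" q] by (simp add: fun_eq_iff)
  then have *: "\<phi> q (\<xi> q) = (\<lambda>h. \<eta> q (\<phi> q (\<xi> q)) * \<xi> q h)"
    using phi_phi[of "\<phi> q (\<xi> q)" q] by (simp add: phi_zero)
  define c where "c = \<eta> q (\<phi> q (\<xi> q))"
  have "0 = \<eta> q (\<phi> q (\<lambda>h. c * \<xi> q h))"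
    using pp * eta_zero by (simp add: c_def)
  also have "\<dots> = c * c"
    by (simp add: phi_scale eta_scale) (simp add: c_def)
  finally show ?thesis
    using * by (simp add: c_def zero_fun_def)
qed

text \<open>Computing \<phi>^3 v as \<phi>(\<phi>^2 v) and as \<phi>^2(\<phi> v) gives two
  expressions that differ by \<eta>(\<phi> v) \<xi>, and \<xi> is nowhere 0.\<close>

lemma eta_phi [simp]:
  assumes "v \<in> T q"
  shows "\<eta> q (\<phi> q v) = 0"
proof -
  have "\<phi> q (\<phi> q (\<phi> q v)) = - \<phi> q v"
    using assms by (simp add: phi_phi[of v] phi_diff phi_scale) (simp add: zero_fun_def fun_eq_iff)
  then have "(\<lambda>h. \<eta> q (\<phi> q v) * \<xi> q h) = 0"
    using phi_phi[of "\<phi> q v" q] assms by simp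
  then show ?thesis
    using xi_nonzero[of q] by (auto simp: fun_eq_iff)
qed

text \<open>Putting \<xi> into the compatibility of g with \<phi> makes its left side vanish, since
  \<phi>(\<xi>) = 0.\<close>

lemma g_xi:
  assumes "v \<in> T q"
  shows "g q v (\<xi> q) = \<eta> q v" "g q (\<xi> q) v = \<eta> q v"
  using g_phi_phi[of v q "\<xi> q"] assms g_sym[of v q "\<xi> q"] by (simp_all add: g_zero_right)

text \<open>Compatibility for the pair \<phi> v, w expresses g(\<phi>^2 v, \<phi> w) as - g(\<phi>
  v, w); expanding \<phi>^2 v gives - g(v, \<phi> w), because \<eta>(\<phi> w) = 0.\<close>

lemma g_phi:
  assumes "v \<in> T q" "w \<in> T q"
  shows "g q (\<phi> q v) w = g q v (\<phi> q w)"
  using g_phi_phi[of "\<phi> q v" q w] assms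
  by (simp add: phi_phi g_linear g_xi)

lemma phi_xi_field [simp]: "\<phi> \<bullet>\<^sub>e \<xi> = 0"
  by (simp add: fun_eq_iff endo_app_apply)

lemma phi_add_field: "X \<in> V \<Longrightarrow> Y \<in> V \<Longrightarrow> \<phi> \<bullet>\<^sub>e (X + Y) = \<phi> \<bullet>\<^sub>e X + \<phi> \<bullet>\<^sub>e Y"
  using phi_add[OF vector_fieldD(1) vector_fieldD(1), of X Y]
  by (auto simp: endo_app_def plus_fun_def)

lemma phi_scale_field: "X \<in> V \<Longrightarrow> \<phi> \<bullet>\<^sub>e (f \<odot> X) = f \<odot> \<phi> \<bullet>\<^sub>e X"
  by (rule ext) (simp add: endo_app_apply fscale_apply phi_scale)

section \<open>The Levi-Civita connection and the covariant derivative of \<eta>\<close>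

lemma connection: "linear_connection \<A> D"
  and torsion_free: "X \<in> V \<Longrightarrow> Y \<in> V \<Longrightarrow> lie_bracket X Y = D X Y - D Y X"
  and metric_compatible: "X \<in> V \<Longrightarrow> Y \<in> V \<Longrightarrow> Z \<in> V \<Longrightarrow> cov_bilin D g X Y Z = 0"
  using lc by (simp_all add: levi_civita_def)

lemma D_field [simp]: "X \<in> V \<Longrightarrow> Y \<in> V \<Longrightarrow> D X Y \<in> V"
  and D_add_left: "X \<in> V \<Longrightarrow> Y \<in> V \<Longrightarrow> Z \<in> V \<Longrightarrow> D (X + Y) Z = D X Z + D Y Z"
  and D_add_right: "X \<in> V \<Longrightarrow> Y \<in> V \<Longrightarrow> Z \<in> V \<Longrightarrow> D X (Y + Z) = D X Y + D X Z"
  and D_scale_left: "f \<in> smooth_functions \<A> \<Longrightarrow> X \<in> V \<Longrightarrow> Y \<in> V \<Longrightarrow> D (f \<odot> X) Y = f \<odot> D X Y"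
  and D_scale_right: "f \<in> smooth_functions \<A> \<Longrightarrow> X \<in> V \<Longrightarrow> Y \<in> V \<Longrightarrow>
    D X (f \<odot> Y) = (\<lambda>q. X q f) \<odot> Y + f \<odot> D X Y"
  using connection by (simp_all add: linear_connection_def)

lemma D_metric:
  assumes "X \<in> V" "Y \<in> V" "Z \<in> V"
  shows "X q (\<lambda>r. g r (Y r) (Z r)) = g q (D X Y q) (Z q) + g q (Y q) (D X Z q)"
  using metric_compatible[OF assms] by (auto simp: cov_bilin_def fun_eq_iff algebra_simps)

lemma zero_field [simp]: "0 \<in> V"
  using vector_field_diff[OF xi_field xi_field] by simp

lemma D_diff_right: "X \<in> V \<Longrightarrow> Y \<in> V \<Longrightarrow> Z \<in> V \<Longrightarrow> D X (Y - Z) = D X Y - D X Z"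
  using D_add_right[of X "Y - Z" Z] by simp

lemma D_zero_right: "X \<in> V \<Longrightarrow> D X 0 = 0"
  using D_add_right[of X 0 0] by simp

text \<open>Since \<eta> is the pairing with \<xi>, metric compatibility cancels every term except
  the derivative of \<xi>. In this form \<open>A\<close> is visibly linear over functions in both
  arguments.\<close>

lemma cov_form_eta:
  assumes "X \<in> V" "Y \<in> V"
  shows "A X Y q = g q (Y q) (D X \<xi> q)"
proof -
  have "(\<lambda>r. \<eta> r (Y r)) = (\<lambda>r. g r (Y r) (\<xi> r))"
    using assms by (simp add: g_xi)
  then show ?thesis
    using D_metric[of X Y \<xi> q] assms by (simp add: cov_form_def g_xi)
qed

text \<open>Differentiating g(\<xi>, \<xi>) = 1 gives twice this quantity.\<close>

lemma A_xi_right: "X \<in> V \<Longrightarrow> A X \<xi> q = 0"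
  using D_metric[of X \<xi> \<xi> q] by (simp add: cov_form_eta g_xi tangent_const[OF vector_fieldD(1)])

lemma A_add_left: "X \<in> V \<Longrightarrow> Y \<in> V \<Longrightarrow> Z \<in> V \<Longrightarrow> A (X + Y) Z q = A X Z q + A Y Z q"
  and A_add_right: "X \<in> V \<Longrightarrow> Y \<in> V \<Longrightarrow> Z \<in> V \<Longrightarrow> A X (Y + Z) q = A X Y q + A X Z q"
  and A_scale_left: "f \<in> smooth_functions \<A> \<Longrightarrow> X \<in> V \<Longrightarrow> Y \<in> V \<Longrightarrow> A (f \<odot> X) Y q = f q * A X Y q"
  and A_scale_right: "f \<in> smooth_functions \<A> \<Longrightarrow> X \<in> V \<Longrightarrow> Y \<in> V \<Longrightarrow> A X (f \<odot> Y) q = f q * A X Y q"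
  by (simp_all add: cov_form_eta D_add_left D_scale_left fscale_apply g_linear)

section \<open>The fundamental tensor F\<close>

lemma cov_endo_field [simp]: "X \<in> V \<Longrightarrow> Y \<in> V \<Longrightarrow> cov_endo D \<phi> X Y \<in> V"
  by (simp add: cov_endo_def)

lemma F_add_left: "X \<in> V \<Longrightarrow> Y \<in> V \<Longrightarrow> Z \<in> V \<Longrightarrow> W \<in> V \<Longrightarrow> F (X + Y) Z W q = F X Z W q + F Y Z W q"
  and F_scale_left: "f \<in> smooth_functions \<A> \<Longrightarrow> X \<in> V \<Longrightarrow> Y \<in> V \<Longrightarrow> Z \<in> V \<Longrightarrow>
    F (f \<odot> X) Y Z q = f q * F X Y Z q"
  and F_add_right: "X \<in> V \<Longrightarrow> Y \<in> V \<Longrightarrow> Z \<in> V \<Longrightarrow> W \<in> V \<Longrightarrow> F X Y (Z + W) q = F X Y Z q + F X Y W q"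
  and F_scale_right: "f \<in> smooth_functions \<A> \<Longrightarrow> X \<in> V \<Longrightarrow> Y \<in> V \<Longrightarrow> Z \<in> V \<Longrightarrow>
    F X Y (f \<odot> Z) q = f q * F X Y Z q"
  by (simp_all add: fundamental_tensor_def cov_endo_def D_add_left D_scale_left phi_add_field phi_scale_field
      fscale_apply endo_app_apply phi_add phi_scale g_linear algebra_simps)

text \<open>This is the covariant derivative of the self-adjointness g(\<phi> y, z) = g(y, \<phi>
  z). It also carries linearity over functions from the last argument to the middle one.\<close>

lemma F_sym:
  assumes "X \<in> V" "Y \<in> V" "Z \<in> V"
  shows "F X Y Z q = F X Z Y q"
proof -
  have "(\<lambda>r. g r ((\<phi> \<bullet>\<^sub>e Y) r) (Z r)) = (\<lambda>r. g r (Y r) ((\<phi> \<bullet>\<^sub>e Z) r))"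
    using assms by (simp add: endo_app_apply g_phi)
  then show ?thesis
    using D_metric[of X "\<phi> \<bullet>\<^sub>e Y" Z q] D_metric[of X Y "\<phi> \<bullet>\<^sub>e Z" q] assms
      g_phi[of "D X Y q" q "Z q"] g_phi[of "Y q" q "D X Z q"]
      g_sym[of "D X (\<phi> \<bullet>\<^sub>e Z) q" q "Y q"] g_sym[of "\<phi> q (D X Z q)" q "Y q"]
    by (simp add: fundamental_tensor_def cov_endo_def endo_app_apply g_diff_left)
qed

lemma F_add_middle: "X \<in> V \<Longrightarrow> Y \<in> V \<Longrightarrow> Z \<in> V \<Longrightarrow> W \<in> V \<Longrightarrow> F X (Y + Z) W q = F X Y W q + F X Z W q"
  using F_sym F_add_right by simp

lemma F_scale_middle: "f \<in> smooth_functions \<A> \<Longrightarrow> X \<in> V \<Longrightarrow> Y \<in> V \<Longrightarrow> Z \<in> V \<Longrightarrow>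
    F X (f \<odot> Y) Z q = f q * F X Y Z q"
  using F_sym F_scale_right by simp

text \<open>Differentiating \<phi>(\<xi>) = 0 gives that the derivative of \<phi>, evaluated on
  \<xi>, is minus \<phi> of the derivative of \<xi>; then \<phi> is moved to the other side of
  g.\<close>

lemma F_xi_middle: "X \<in> V \<Longrightarrow> Z \<in> V \<Longrightarrow> F X \<xi> Z q = - A X (\<phi> \<bullet>\<^sub>e Z) q"
  using g_sym[of "\<phi> q (Z q)" q "D X \<xi> q"]
  by (simp add: fundamental_tensor_def cov_endo_def D_zero_right cov_form_eta endo_app_apply
      g_uminus_left g_phi)

lemma F_xi_right: "X \<in> V \<Longrightarrow> Y \<in> V \<Longrightarrow> F X Y \<xi> q = - A X (\<phi> \<bullet>\<^sub>e Y) q"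
  using F_sym[of X Y \<xi> q] by (simp add: F_xi_middle)

text \<open>This is the covariant derivative of \<phi>^2 = - id + \<eta> \<otimes> \<xi>, paired
  with \<open>Z\<close>. The two terms with \<open>A\<close> come from differentiating \<eta> and
  \<xi>.\<close>

lemma F_phi_right:
  assumes "X \<in> V" "Y \<in> V" "Z \<in> V"
  shows "F X Y (\<phi> \<bullet>\<^sub>e Z) q = - F X (\<phi> \<bullet>\<^sub>e Y) Z q + A X Y q * \<eta> q (Z q) + \<eta> q (Y q) * A X Z q"
proof -
  have "F X (\<phi> \<bullet>\<^sub>e Y) Z q + F X Y (\<phi> \<bullet>\<^sub>e Z) q =
      g q (D X (\<phi> \<bullet>\<^sub>e \<phi> \<bullet>\<^sub>e Y) q - \<phi> q (\<phi> q (D X Y q))) (Z q)"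
    using assms by (simp add: fundamental_tensor_def cov_endo_def endo_app_apply g_linear
        g_phi[symmetric] phi_diff)
  also have "\<dots> = (X q (\<lambda>r. \<eta> r (Y r)) - \<eta> q (D X Y q)) * \<eta> q (Z q) + \<eta> q (Y q) * g q (D X \<xi> q) (Z q)"
    using assms by (simp add: phi_phi_field phi_phi D_diff_right D_scale_right
        tangent_const[OF vector_fieldD(1)] vector_fieldD(2) g_linear g_xi fscale_apply) (simp add: algebra_simps)
  also have "\<dots> = A X Y q * \<eta> q (Z q) + \<eta> q (Y q) * A X Z q"
    using assms g_sym[of "D X \<xi> q" q "Z q"] by (simp add: cov_form_eta[of X Z]) (simp add: cov_form_def)
  finally show ?thesis by simp
qed

lemma F_zero: "X \<in> V \<Longrightarrow> Y \<in> V \<Longrightarrow> F 0 X Y q = 0" "X \<in> V \<Longrightarrow> Y \<in> V \<Longrightarrow> F X Y 0 q = 0"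
    "X \<in> V \<Longrightarrow> Y \<in> V \<Longrightarrow> F X 0 Y q = 0"
  using F_add_left[of 0 0 X Y q] F_add_right[of X Y 0 0 q] F_add_middle[of X 0 0 Y q] by simp_all

lemma A_zero: "X \<in> V \<Longrightarrow> A 0 X q = 0" "X \<in> V \<Longrightarrow> A X 0 q = 0"
  using A_add_left[of 0 0 X q] A_add_right[of X 0 0 q] by simp_all

lemma F_diff: "X \<in> V \<Longrightarrow> Y \<in> V \<Longrightarrow> Z \<in> V \<Longrightarrow> W \<in> V \<Longrightarrow> F (X - Y) Z W q = F X Z W q - F Y Z W q"
    "X \<in> V \<Longrightarrow> Y \<in> V \<Longrightarrow> Z \<in> V \<Longrightarrow> W \<in> V \<Longrightarrow> F X (Y - Z) W q = F X Y W q - F X Z W q"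
  using F_add_left[of "X - Y" Y Z W q] F_add_middle[of X "Y - Z" Z W q] by simp_all

lemma A_diff: "X \<in> V \<Longrightarrow> Y \<in> V \<Longrightarrow> Z \<in> V \<Longrightarrow> A (X - Y) Z q = A X Z q - A Y Z q"
    "X \<in> V \<Longrightarrow> Y \<in> V \<Longrightarrow> Z \<in> V \<Longrightarrow> A X (Y - Z) q = A X Y q - A X Z q"
  using A_add_left[of "X - Y" Y Z q] A_add_right[of X "Y - Z" Z q] by simp_all

lemmas F_linear = F_add_left F_add_middle F_add_right F_scale_left F_scale_middle F_scale_right
  F_zero F_diff
lemmas A_linear = A_add_left A_add_right A_scale_left A_scale_right A_zero A_diff

section \<open>The Nijenhuis tensor in terms of F\<close>

lemma nijenhuis_F:
  assumes "X \<in> V" "Y \<in> V" "Z \<in> V"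
  shows "N X Y Z q = F (\<phi> \<bullet>\<^sub>e X) Y Z q - F (\<phi> \<bullet>\<^sub>e Y) X Z q - F X Y (\<phi> \<bullet>\<^sub>e Z) q + F Y X (\<phi> \<bullet>\<^sub>e Z) q
    + (A X Y q - A Y X q) * \<eta> q (Z q)"
  using assms
  \<comment> \<open>Vanishing torsion replaces each Lie bracket by covariant derivatives, which
    regroup into derivatives of \<phi> because \<phi> is self-adjoint.\<close>
  by (simp add: nijenhuis_tensor_def nijenhuis_field_def torsion_free fundamental_tensor_def cov_endo_def
      endo_app_apply fscale_apply g_linear g_phi g_xi)

lemma N_skew: "X \<in> V \<Longrightarrow> Y \<in> V \<Longrightarrow> Z \<in> V \<Longrightarrow> N X Y Z q = - N Y X Z q"
  by (simp add: nijenhuis_F algebra_simps)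

lemma N_add_left: "X \<in> V \<Longrightarrow> Y \<in> V \<Longrightarrow> Z \<in> V \<Longrightarrow> W \<in> V \<Longrightarrow> N (X + Y) Z W q = N X Z W q + N Y Z W q"
  and N_scale_left: "f \<in> smooth_functions \<A> \<Longrightarrow> X \<in> V \<Longrightarrow> Y \<in> V \<Longrightarrow> Z \<in> V \<Longrightarrow>
    N (f \<odot> X) Y Z q = f q * N X Y Z q"
  and N_add_right: "X \<in> V \<Longrightarrow> Y \<in> V \<Longrightarrow> Z \<in> V \<Longrightarrow> W \<in> V \<Longrightarrow> N X Y (Z + W) q = N X Y Z q + N X Y W q"
  and N_scale_right: "f \<in> smooth_functions \<A> \<Longrightarrow> X \<in> V \<Longrightarrow> Y \<in> V \<Longrightarrow> Z \<in> V \<Longrightarrow>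
    N X Y (f \<odot> Z) q = f q * N X Y Z q"
  by (simp_all add: nijenhuis_F F_linear A_linear phi_add_field phi_scale_field fscale_apply eta_add eta_scale
      algebra_simps)

lemma N_add_middle: "X \<in> V \<Longrightarrow> Y \<in> V \<Longrightarrow> Z \<in> V \<Longrightarrow> W \<in> V \<Longrightarrow> N X (Y + Z) W q = N X Y W q + N X Z W q"
  using N_skew[of X _ W q] N_add_left by simp

lemma N_scale_middle: "f \<in> smooth_functions \<A> \<Longrightarrow> X \<in> V \<Longrightarrow> Y \<in> V \<Longrightarrow> Z \<in> V \<Longrightarrow>
    N X (f \<odot> Y) Z q = f q * N X Y Z q"
  using N_skew[of X _ Z q] N_scale_left by simp

lemma N_zero: "X \<in> V \<Longrightarrow> Y \<in> V \<Longrightarrow> N 0 X Y q = 0" "X \<in> V \<Longrightarrow> Y \<in> V \<Longrightarrow> N X 0 Y q = 0"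
  using N_add_left[of 0 0 X Y q] N_add_middle[of X 0 0 Y q] by simp_all

lemma N_diff: "X \<in> V \<Longrightarrow> Y \<in> V \<Longrightarrow> Z \<in> V \<Longrightarrow> W \<in> V \<Longrightarrow> N (X - Y) Z W q = N X Z W q - N Y Z W q"
    "X \<in> V \<Longrightarrow> Y \<in> V \<Longrightarrow> Z \<in> V \<Longrightarrow> W \<in> V \<Longrightarrow> N X (Y - Z) W q = N X Y W q - N X Z W q"
  using N_add_left[of "X - Y" Y Z W q] N_add_middle[of X "Y - Z" Z W q] by simp_all

lemmas N_linear = N_add_left N_add_middle N_add_right N_scale_left N_scale_middle N_scale_right
  N_zero N_diff

text \<open>Moving \<phi> between the first two arguments of \<open>N\<close> costs only terms with
  a factor \<eta>(y) or \<eta>(z), produced by \<phi>^2 = - id + \<eta> \<otimes> \<xi>. The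
  correction terms of \<open>H\<close> are made to absorb them.\<close>

lemma N_phi:
  assumes "Y \<in> V" "Z \<in> V" "W \<in> V"
  shows "N (\<phi> \<bullet>\<^sub>e Y) Z W q - N Y (\<phi> \<bullet>\<^sub>e Z) W q =
    \<eta> q (Z q) * N (\<phi> \<bullet>\<^sub>e Y) \<xi> W q + \<eta> q (Y q) * N (\<phi> \<bullet>\<^sub>e Z) \<xi> W q"
  using assms
  by (simp add: nijenhuis_F F_phi_right phi_phi_field F_linear A_linear A_xi_right F_xi_middle
      endo_app_apply algebra_simps)


subsection \<open>Naturality\<close>

text \<open>This is \<open>N\<close> on the projections x - \<eta>(x) \<xi> and y - \<eta>(y) \<xi>,
  expanded with the help of N(\<xi>, \<xi>, z) = 0.\<close>

definition horizontal_nijenhuis :: "'m vfield \<Rightarrow> 'm vfield \<Rightarrow> 'm vfield \<Rightarrow> 'm \<Rightarrow> real" where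
  "horizontal_nijenhuis X Y Z q = N X Y Z q + N \<xi> X Z q * \<eta> q (Y q) + N Y \<xi> Z q * \<eta> q (X q)"

abbreviation "H \<equiv> horizontal_nijenhuis"

lemma H_skew: "X \<in> V \<Longrightarrow> Y \<in> V \<Longrightarrow> Z \<in> V \<Longrightarrow> H X Y Z q = - H Y X Z q"
  using N_skew[of X Y Z q] N_skew[of \<xi> X Z q] N_skew[of \<xi> Y Z q]
  by (simp add: horizontal_nijenhuis_def)

lemma H_xi: "X \<in> V \<Longrightarrow> Z \<in> V \<Longrightarrow> H X \<xi> Z q = 0"
  using N_skew[of X \<xi> Z q] N_skew[of \<xi> \<xi> Z q]
  by (simp add: horizontal_nijenhuis_def)

text \<open>As \<eta> vanishes on the image of \<phi>, one correction term survives on each side,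
  and together they match the right side of \<open>N_phi\<close>.\<close>

lemma H_phi: "X \<in> V \<Longrightarrow> Y \<in> V \<Longrightarrow> Z \<in> V \<Longrightarrow> H (\<phi> \<bullet>\<^sub>e X) Y Z q = H X (\<phi> \<bullet>\<^sub>e Y) Z q"
  using N_phi[of X Y Z q] N_skew[of \<xi> "\<phi> \<bullet>\<^sub>e X" Z q]
  by (simp add: horizontal_nijenhuis_def endo_app_apply algebra_simps)

lemma H_linear:
  "X \<in> V \<Longrightarrow> Y \<in> V \<Longrightarrow> Z \<in> V \<Longrightarrow> W \<in> V \<Longrightarrow> H (X + Y) Z W q = H X Z W q + H Y Z W q"
  "X \<in> V \<Longrightarrow> Y \<in> V \<Longrightarrow> Z \<in> V \<Longrightarrow> W \<in> V \<Longrightarrow> H X Y (Z + W) q = H X Y Z q + H X Y W q"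
  "f \<in> smooth_functions \<A> \<Longrightarrow> X \<in> V \<Longrightarrow> Y \<in> V \<Longrightarrow> Z \<in> V \<Longrightarrow> H (f \<odot> X) Y Z q = f q * H X Y Z q"
  "f \<in> smooth_functions \<A> \<Longrightarrow> X \<in> V \<Longrightarrow> Y \<in> V \<Longrightarrow> Z \<in> V \<Longrightarrow> H X Y (f \<odot> Z) q = f q * H X Y Z q"
  by (simp_all add: horizontal_nijenhuis_def N_linear eta_add eta_scale fscale_apply algebra_simps)

text \<open>The difference of the two connections, lowered with g and rewritten with
  \<open>H\<close> and with \<open>A X Y\<close> in place of F(x, \<phi> y, \<xi>).\<close>

definition deformation :: "real \<Rightarrow> real \<Rightarrow> real \<Rightarrow> real \<Rightarrow> 'm vfield \<Rightarrow> 'm vfield \<Rightarrow> 'm vfield \<Rightarrow> 'm \<Rightarrow> real" where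
  "deformation p1 p2 p3 p4 X Y Z q =
    1 / 2 * (F X (\<phi> \<bullet>\<^sub>e Y) Z q + A X Y q * \<eta> q (Z q)) - A X Z q * \<eta> q (Y q)
    + p1 * H Y Z (\<phi> \<bullet>\<^sub>e X) q - p2 * H Y Z X q
    + (p3 * H Y Z \<xi> q + p4 * H Y (\<phi> \<bullet>\<^sub>e Z) \<xi> q) * \<eta> q (X q)"

text \<open>Here \<open>F_xi_right\<close> yields - \<open>A\<close> at \<phi>^2 y = \<eta>(y) \<xi>
  - y, and \<open>A\<close> vanishes on \<xi>.\<close>

lemma F_phi_xi: "X \<in> V \<Longrightarrow> Y \<in> V \<Longrightarrow> F X (\<phi> \<bullet>\<^sub>e Y) \<xi> q = A X Y q"
  by (simp add: F_xi_right phi_phi_field A_linear A_xi_right)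

lemma deformation_eq:
  assumes "X \<in> V" "Y \<in> V" "Z \<in> V"
  shows "1 / 2 * (F X (\<phi> \<bullet>\<^sub>e Y) Z q + F X (\<phi> \<bullet>\<^sub>e Y) \<xi> q * \<eta> q (Z q))
    - F X (\<phi> \<bullet>\<^sub>e Z) \<xi> q * \<eta> q (Y q)
    + p1 * (N Y Z (\<phi> \<bullet>\<^sub>e X) q + N \<xi> Y (\<phi> \<bullet>\<^sub>e X) q * \<eta> q (Z q) + N Z \<xi> (\<phi> \<bullet>\<^sub>e X) q * \<eta> q (Y q))
    + p2 * (N Z Y X q + N Y \<xi> X q * \<eta> q (Z q) + N \<xi> Z X q * \<eta> q (Y q))
    + p3 * (N (\<phi> \<bullet>\<^sub>e \<phi> \<bullet>\<^sub>e Z) Y \<xi> q + N Z \<xi> \<xi> q * \<eta> q (Y q)) * \<eta> q (X q)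
    + p4 * (N Y (\<phi> \<bullet>\<^sub>e Z) \<xi> q + N (\<phi> \<bullet>\<^sub>e Z) \<xi> \<xi> q * \<eta> q (Y q)) * \<eta> q (X q)
    = deformation p1 p2 p3 p4 X Y Z q"
proof -
  have "N Z Y X q + N Y \<xi> X q * \<eta> q (Z q) + N \<xi> Z X q * \<eta> q (Y q) = - H Y Z X q"
    using assms N_skew[of Z Y X q] N_skew[of Y \<xi> X q] N_skew[of \<xi> Z X q]
    by (simp add: horizontal_nijenhuis_def)
  \<comment> \<open>Expanding \<phi>^2 z = \<eta>(z) \<xi> - z supplies the correction term with
    \<eta>(z); skew symmetry turns - N(z, y, \<xi>) into N(y, z, \<xi>).\<close>
  moreover have "N (\<phi> \<bullet>\<^sub>e \<phi> \<bullet>\<^sub>e Z) Y \<xi> q + N Z \<xi> \<xi> q * \<eta> q (Y q) = H Y Z \<xi> q"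
    using assms N_skew[of Z Y \<xi> q] by (simp add: horizontal_nijenhuis_def phi_phi_field N_linear)
  \<comment> \<open>The correction term of \<open>H\<close> that is missing on the left carries the
    factor \<eta>(\<phi> z) = 0.\<close>
  moreover have "N Y (\<phi> \<bullet>\<^sub>e Z) \<xi> q + N (\<phi> \<bullet>\<^sub>e Z) \<xi> \<xi> q * \<eta> q (Y q) = H Y (\<phi> \<bullet>\<^sub>e Z) \<xi> q"
    using assms by (simp add: horizontal_nijenhuis_def endo_app_apply)
  ultimately show ?thesis
    using assms by (simp add: deformation_def F_phi_xi horizontal_nijenhuis_def[of Y Z "\<phi> \<bullet>\<^sub>e X"] algebra_simps)
qed

section \<open>Linearity of the deformation over functions\<close>

lemma deformation_add_left:
  "X \<in> V \<Longrightarrow> Y \<in> V \<Longrightarrow> Z \<in> V \<Longrightarrow> W \<in> V \<Longrightarrow> deformation p1 p2 p3 p4 (X + Y) Z W q =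
    deformation p1 p2 p3 p4 X Z W q + deformation p1 p2 p3 p4 Y Z W q"
  by (simp add: deformation_def F_linear A_linear H_linear phi_add_field eta_add algebra_simps)

lemma deformation_add_middle:
  "X \<in> V \<Longrightarrow> Y \<in> V \<Longrightarrow> Z \<in> V \<Longrightarrow> W \<in> V \<Longrightarrow> deformation p1 p2 p3 p4 X (Y + Z) W q =
    deformation p1 p2 p3 p4 X Y W q + deformation p1 p2 p3 p4 X Z W q"
  by (simp add: deformation_def F_linear A_linear H_linear phi_add_field eta_add algebra_simps add_divide_distrib)

lemma deformation_scale_left:
  "f \<in> smooth_functions \<A> \<Longrightarrow> X \<in> V \<Longrightarrow> Y \<in> V \<Longrightarrow> Z \<in> V \<Longrightarrow>
    deformation p1 p2 p3 p4 (f \<odot> X) Y Z q = f q * deformation p1 p2 p3 p4 X Y Z q"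
  by (simp add: deformation_def F_linear A_linear H_linear phi_scale_field eta_scale fscale_apply algebra_simps)

lemma deformation_scale_middle:
  "f \<in> smooth_functions \<A> \<Longrightarrow> X \<in> V \<Longrightarrow> Y \<in> V \<Longrightarrow> Z \<in> V \<Longrightarrow>
    deformation p1 p2 p3 p4 X (f \<odot> Y) Z q = f q * deformation p1 p2 p3 p4 X Y Z q"
  by (simp add: deformation_def F_linear A_linear H_linear phi_scale_field eta_scale fscale_apply algebra_simps)

text \<open>This identity gives the parallelism of \<eta>. The two halves of the first bracket both
  equal \<open>A X Y\<close> divided by 2, and all terms with \<open>H\<close> vanish at
  \<xi>.\<close>

lemma deformation_xi: "X \<in> V \<Longrightarrow> Y \<in> V \<Longrightarrow> deformation p1 p2 p3 p4 X Y \<xi> q = A X Y q"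
  using H_phi[of Y \<xi> \<xi> q]
  by (simp add: deformation_def F_phi_xi A_xi_right H_xi)

text \<open>This identity preserves metric compatibility. Symmetrising in y and z, the first bracket
  contributes half of twice the symmetric sum of terms \<open>A\<close> times \<eta>, which the
  subtracted term cancels.\<close>

lemma deformation_skew:
  assumes "X \<in> V" "Y \<in> V" "Z \<in> V"
  shows "deformation p1 p2 p3 p4 X Y Z q = - deformation p1 p2 p3 p4 X Z Y q"
proof -
  have "F X (\<phi> \<bullet>\<^sub>e Y) Z q + F X (\<phi> \<bullet>\<^sub>e Z) Y q = A X Y q * \<eta> q (Z q) + A X Z q * \<eta> q (Y q)"
    using F_phi_right[of X Y Z q] F_sym[of X Y "\<phi> \<bullet>\<^sub>e Z" q] assms by simp
  moreover have "H Y (\<phi> \<bullet>\<^sub>e Z) \<xi> q = - H Z (\<phi> \<bullet>\<^sub>e Y) \<xi> q"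
    using H_phi[of Z Y \<xi> q] H_skew[of Y "\<phi> \<bullet>\<^sub>e Z" \<xi> q] assms by simp
  ultimately show ?thesis
    using H_skew[of Y Z "\<phi> \<bullet>\<^sub>e X" q] H_skew[of Y Z X q] H_skew[of Y Z \<xi> q] assms
    by (simp add: deformation_def algebra_simps)
qed

text \<open>The left side is the change in the derivative of \<phi>, so the identity gives the
  parallelism of \<phi>. Terms with \<open>H\<close> cancel by \<open>H_phi\<close>. In the rest,
  each of the two halved F terms contributes half of - F(x, y, z), and the terms with
  \<open>A\<close> cancel.\<close>

lemma deformation_phi:
  assumes "X \<in> V" "Y \<in> V" "Z \<in> V"
  shows "deformation p1 p2 p3 p4 X (\<phi> \<bullet>\<^sub>e Y) Z q - deformation p1 p2 p3 p4 X Y (\<phi> \<bullet>\<^sub>e Z) q = - F X Y Z q"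
  using assms
  by (simp add: deformation_def H_phi F_phi_right phi_phi_field F_linear A_linear A_xi_right F_xi_middle
      endo_app_apply[of _ _ q] algebra_simps)

text \<open>Pairing with every field determines \<open>D''\<close>, so each connection axiom follows
  from the one for \<open>D\<close> and linearity of the deformation. The three identities above
  then give parallelism of \<phi>, \<eta> and g.\<close>

lemma natural_connection_deformation:
  assumes closed: "\<And>X Y. X \<in> V \<Longrightarrow> Y \<in> V \<Longrightarrow> D'' X Y \<in> V"
    and eq: "\<And>X Y Z q. X \<in> V \<Longrightarrow> Y \<in> V \<Longrightarrow> Z \<in> V \<Longrightarrow>
      g q (D'' X Y q - D X Y q) (Z q) = deformation p1 p2 p3 p4 X Y Z q"
  shows "natural_connection \<A> \<phi> \<eta> g D''"
proof -
  note [simp] = closed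
  have g_D'': "g q (D'' X Y q) (Z q) = g q (D X Y q) (Z q) + deformation p1 p2 p3 p4 X Y Z q"
    if "X \<in> V" "Y \<in> V" "Z \<in> V" for X Y Z q
    using eq[OF that, of q] that by (simp add: g_diff_left)
  have field_eqI: "X = Y" if "X \<in> V" "Y \<in> V" "\<And>Z q. Z \<in> V \<Longrightarrow> g q (X q) (Z q) = g q (Y q) (Z q)" for X Y
    by (rule ext, rule tangent_eqI) (use that in auto)
  show ?thesis
    unfolding natural_connection_def linear_connection_def
  proof (intro conjI ballI)
    fix X Y assume X: "X \<in> V" and Y: "Y \<in> V"
    show "D'' X Y \<in> V"
      using X Y by simp
    show "cov_endo D'' \<phi> X Y = 0"
    proof (rule field_eqI)
      fix Z q assume Z: "Z \<in> V"
      \<comment> \<open>Self-adjointness moves \<phi> onto the test field, so that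
        \<open>g_D''\<close> applies with \<phi> z in place of z.\<close>
      have "g q (\<phi> q (D'' X Y q)) (Z q) = g q (D'' X Y q) ((\<phi> \<bullet>\<^sub>e Z) q)"
        "g q (\<phi> q (D X Y q)) (Z q) = g q (D X Y q) ((\<phi> \<bullet>\<^sub>e Z) q)"
        using X Y Z by (simp_all add: g_phi endo_app_apply)
      then show "g q (cov_endo D'' \<phi> X Y q) (Z q) = g q (0 q) (Z q)"
        using deformation_phi[OF X Y Z, of p1 p2 p3 p4 q] X Y Z
        by (simp add: cov_endo_def fundamental_tensor_def endo_app_apply[of _ "D'' X Y"]
            endo_app_apply[of _ "D X Y"] g_diff_left g_D'' g_zero_left)
    qed (use X Y in \<open>simp_all add: cov_endo_def\<close>)
    show "cov_form D'' \<eta> X Y = 0"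
    proof
      fix q
      \<comment> \<open>As \<eta> is the pairing with \<xi>, the deformation is evaluated at \<xi>
        in its last argument; the change \<open>A X Y\<close> is exactly what the derivative of
        \<eta> under \<open>D\<close> contributes.\<close>
      have "\<eta> q (D'' X Y q) = \<eta> q (D X Y q) + A X Y q"
        using g_D''[OF X Y xi_field, of q] X Y by (simp add: g_xi deformation_xi)
      then show "cov_form D'' \<eta> X Y q = 0 q"
        by (simp add: cov_form_def)
    qed
    fix Z assume Z: "Z \<in> V"
    show "cov_bilin D'' g X Y Z = 0"
    proof
      fix q
      have "g q (Y q) (D'' X Z q) = g q (Y q) (D X Z q) + deformation p1 p2 p3 p4 X Z Y q"
        using g_D''[OF X Z Y, of q] g_sym[of "Y q" q] X Y Z by simp
      then show "cov_bilin D'' g X Y Z q = 0 q"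
        using D_metric[OF X Y Z, of q] g_D''[OF X Y Z, of q] deformation_skew[OF X Y Z, of p1 p2 p3 p4 q]
        by (simp add: cov_bilin_def)
    qed
    show "D'' (X + Y) Z = D'' X Z + D'' Y Z"
      by (rule field_eqI) (use X Y Z in \<open>simp_all add: g_D'' g_add_left D_add_left deformation_add_left\<close>)
    show "D'' X (Y + Z) = D'' X Y + D'' X Z"
      by (rule field_eqI) (use X Y Z in \<open>simp_all add: g_D'' g_add_left D_add_right deformation_add_middle\<close>)
  next
    fix f X Y assume f: "f \<in> smooth_functions \<A>" and X: "X \<in> V" and Y: "Y \<in> V"
    note [simp] = f X Y
    have [simp]: "(\<lambda>q. X q f) \<in> smooth_functions \<A>"
      using f X by (simp add: vector_fieldD(2))
    show "D'' (f \<odot> X) Y = f \<odot> D'' X Y"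
      by (rule field_eqI)
        (simp_all add: g_D'' g_scale_left D_scale_left deformation_scale_left fscale_apply algebra_simps)
    show "D'' X (f \<odot> Y) = (\<lambda>q. X q f) \<odot> Y + f \<odot> D'' X Y"
      by (rule field_eqI)
        (simp_all add: g_D'' g_add_left g_scale_left D_scale_right deformation_scale_middle fscale_apply algebra_simps)
  qed
qed

end

theorem theorem2p2:
  fixes \<A> :: "('m::{t2_space,second_countable_topology}, 'e::euclidean_space) chart set"
    and n :: nat
    and \<phi> :: "'m endo" and \<xi> :: "'m vfield" and \<eta> :: "'m form" and g :: "'m bilin"
    and D D'' :: "'m vfield \<Rightarrow> 'm vfield \<Rightarrow> 'm vfield"
    and F N :: "'m vfield \<Rightarrow> 'm vfield \<Rightarrow> 'm vfield \<Rightarrow> 'm \<Rightarrow> real"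
    and p1 p2 p3 p4 :: real
  assumes manifold: "smooth_atlas \<A>" "DIM('e) = 2 * n + 1"
    and acn: "almost_contact_norden \<A> \<phi> \<xi> \<eta> g"
    and levi_civita: "levi_civita \<A> g D"
    and F: "F = fundamental_tensor \<phi> g D"
    and N: "N = nijenhuis_tensor \<phi> \<xi> \<eta> g D"
    and closed: "\<And>x y. x \<in> vector_fields \<A> \<Longrightarrow> y \<in> vector_fields \<A> \<Longrightarrow> D'' x y \<in> vector_fields \<A>"
    and eq: "\<And>x y z q. x \<in> vector_fields \<A> \<Longrightarrow> y \<in> vector_fields \<A> \<Longrightarrow> z \<in> vector_fields \<A> \<Longrightarrow>
      g q (D'' x y q - D x y q) (z q) =
        1 / 2 * (F x (\<phi> \<bullet>\<^sub>e y) z q + F x (\<phi> \<bullet>\<^sub>e y) \<xi> q * \<eta> q (z q))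
        - F x (\<phi> \<bullet>\<^sub>e z) \<xi> q * \<eta> q (y q)
        + p1 * (N y z (\<phi> \<bullet>\<^sub>e x) q + N \<xi> y (\<phi> \<bullet>\<^sub>e x) q * \<eta> q (z q) + N z \<xi> (\<phi> \<bullet>\<^sub>e x) q * \<eta> q (y q))
        + p2 * (N z y x q + N y \<xi> x q * \<eta> q (z q) + N \<xi> z x q * \<eta> q (y q))
        + p3 * (N (\<phi> \<bullet>\<^sub>e \<phi> \<bullet>\<^sub>e z) y \<xi> q + N z \<xi> \<xi> q * \<eta> q (y q)) * \<eta> q (x q)
        + p4 * (N y (\<phi> \<bullet>\<^sub>e z) \<xi> q + N (\<phi> \<bullet>\<^sub>e z) \<xi> \<xi> q * \<eta> q (y q)) * \<eta> q (x q)"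
  shows "natural_connection \<A> \<phi> \<eta> g D''"
proof -
  interpret M: almost_contact_norden_manifold \<A> \<phi> \<xi> \<eta> g D
    by unfold_locales (fact manifold(1) acn levi_civita)+
  show ?thesis
  proof (rule M.natural_connection_deformation[OF closed])
    fix X Y Z q
    assume "X \<in> vector_fields \<A>" "Y \<in> vector_fields \<A>" "Z \<in> vector_fields \<A>"
    then show "g q (D'' X Y q - D X Y q) (Z q) = M.deformation p1 p2 p3 p4 X Y Z q"
      by (simp only: eq F N M.deformation_eq)
  qed
qed

end
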